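(* Let $k$ be a field and let $m\ge 2$ and $0\le d<m$ be integers. There exists a monomial ideal $I$ in $R=k[x,y,z,u,v]$ such that for all integers $t\ge 1$, $$\operatorname{depth} R/I^{(t)}=\begin{cases}2 & \text{if } t\equiv d \pmod m,\\ 1 & \text{otherwise}.\end{cases}$$
   Context: For a homogeneous ideal $I$ of $R$ and $t\ge 0$, the $t$-th symbolic power $I^{(t)}$ is the intersection of the primary components of $I^t$ associated with the minimal primes of $I$. *)

theory Defs
  imports Main "HOL-Library.Poly_Mapping" "HOL-Library.Extended_Nat"
begin

datatype var = X | Y | Z | U | V

text \<open>Polynomials over k in the five variables: finitely supported maps from
exponent vectors (var \<Rightarrow>0 nat) to coefficients, with convolution product.\<close>
type_synonym 'k poly5 = "(var \<Rightarrow>\<^sub>0 nat) \<Rightarrow>\<^sub>0 'k"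

definition varp :: "var \<Rightarrow> 'k::comm_ring_1 poly5" where
  "varp i = Poly_Mapping.single (Poly_Mapping.single i 1) 1"

definition monomial5 :: "(var \<Rightarrow>\<^sub>0 nat) \<Rightarrow> 'k::comm_ring_1 poly5" where
  "monomial5 \<alpha> = Poly_Mapping.single \<alpha> 1"

definition is_ideal :: "'a::comm_ring_1 set \<Rightarrow> bool" where
  "is_ideal I \<longleftrightarrow> 0 \<in> I \<and> (\<forall>a\<in>I. \<forall>b\<in>I. a + b \<in> I) \<and> (\<forall>r. \<forall>a\<in>I. r * a \<in> I)"

definition ideal_gen :: "'a::comm_ring_1 set \<Rightarrow> 'a set" where
  "ideal_gen S = {\<Sum>s\<in>F. r s * s | F r. finite F \<and> F \<subseteq> S}"

definition ideal_pow :: "'a::comm_ring_1 set \<Rightarrow> nat \<Rightarrow> 'a set" where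
  "ideal_pow I t = ideal_gen {prod_list fs | fs. length fs = t \<and> set fs \<subseteq> I}"

definition prime_ideal :: "'a::comm_ring_1 set \<Rightarrow> bool" where
  "prime_ideal P \<longleftrightarrow> is_ideal P \<and> 1 \<notin> P \<and> (\<forall>a b. a * b \<in> P \<longrightarrow> a \<in> P \<or> b \<in> P)"

definition minimal_primes :: "'a::comm_ring_1 set \<Rightarrow> 'a set set" where
  "minimal_primes I = {P. prime_ideal P \<and> I \<subseteq> P \<and>
      \<not> (\<exists>Q. prime_ideal Q \<and> I \<subseteq> Q \<and> Q \<subset> P)}"

text \<open>The primary component of J belonging to a minimal prime P of J is
  J R_P \<inter> R = {f. \<exists>s\<notin>P. s f \<in> J}; it is uniquely determined.
  The t-th symbolic power is the intersection of the primary components of I^t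
  associated with the minimal primes of I (which are the minimal primes of I^t).\<close>
definition primary_component_at :: "'a::comm_ring_1 set \<Rightarrow> 'a set \<Rightarrow> 'a set" where
  "primary_component_at J P = {f. \<exists>s. s \<notin> P \<and> s * f \<in> J}"

definition symbolic_power :: "'a::comm_ring_1 set \<Rightarrow> nat \<Rightarrow> 'a set" where
  "symbolic_power I t = (\<Inter>P\<in>minimal_primes I. primary_component_at (ideal_pow I t) P)"

definition max_ideal5 :: "'k::comm_ring_1 poly5 set" where
  "max_ideal5 = ideal_gen (range varp)"

definition regular_seq :: "'a::comm_ring_1 set \<Rightarrow> 'a set \<Rightarrow> 'a list \<Rightarrow> bool" where
  "regular_seq M J fs \<longleftrightarrow> set fs \<subseteq> M \<and>
     (\<forall>i < length fs. \<forall>g. g * fs ! i \<in> ideal_gen (J \<union> set (take i fs))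
                         \<longrightarrow> g \<in> ideal_gen (J \<union> set (take i fs))) \<and>
     1 \<notin> ideal_gen (J \<union> set fs)"

definition depth_quot :: "'a::comm_ring_1 set \<Rightarrow> 'a set \<Rightarrow> enat" where
  "depth_quot M J = Sup {enat (length fs) | fs. regular_seq M J fs}"

definition monomial_ideal :: "'k::comm_ring_1 poly5 set \<Rightarrow> bool" where
  "monomial_ideal I \<longleftrightarrow> (\<exists>A. I = ideal_gen (monomial5 ` A))"

end

theory Submission
  imports Defs
begin

text \<open>
  Take I = A \<inter> B \<inter> C with monomial ideals A, B, C that are primary to (z, u, v), (x, y) and
  (x, z, v). Then I^(t) = A^t \<inter> B^t \<inter> C^t. The complements {x, y}, {z, u, v} and {y, u} of the
  three supports form a connected complex, but the first two are disjoint. A monomial in C^t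
  outside A^t and B^t therefore disconnects a degree complex and forces depth 1 through a
  1-cocycle of the Koszul complex. If there is no such monomial, then
  C^t = (A^t \<inter> C^t) + (B^t \<inter> C^t) and the depth lemma shows that y + u, x + y + v is a regular
  sequence; a socle monomial of C^t lying in A^t and B^t yields a Koszul 2-cocycle, so that the
  depth is 2. The ideals are chosen such that C^t is contained in A^t \<union> B^t, on monomials,
  exactly if t \<equiv> d modulo m.
\<close>

text \<open>The degree complex at an exponent has as facets the complements of the supports of those
  components that miss it. The supports of A and B together contain all five variables, so these two
  alone can leave a gap; C bridges it, because y is free modulo A and C, and u is free modulo B and
  C. The gap is visible only at a monomial of C^t outside A^t and B^t, and so the depth at t is
  decided by one inclusion of exponent sets.

  The obstacle is to make this inclusion depend on t modulo m for all t, although taking powers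
  tends to wash out arithmetic conditions. A keeps the condition because its defect does not grow:
  among the u-free monomials of A^t, those of weight 4mt and 4mt + 1 are the ones whose z exponent
  must be divisible by m. C contributes, up to multiples, one critical monomial of weight 4mt + 1,
  and its z exponent increases by one with t.\<close>

primrec var_index :: "var \<Rightarrow> nat" where
  "var_index X = 0"
| "var_index Y = 1"
| "var_index Z = 2"
| "var_index U = 3"
| "var_index V = 4"

lemma var_index_inject: "var_index i = var_index j \<longleftrightarrow> i = j"
  by (cases i; cases j) simp_all

lemma UNIV_var: "UNIV = {X, Y, Z, U, V}"
  using var.exhaust by auto

instance var :: finite
  by standard (simp add: UNIV_var)

text \<open>With a linear order on the variables the exponent vectors are ordered lexicographically,
  compatibly with addition, so that leading terms are available.\<close>

instantiation var :: linorder
begin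

definition "i \<le> j \<longleftrightarrow> var_index i \<le> var_index j"
definition "i < j \<longleftrightarrow> var_index i < var_index j"

instance
  by standard (auto simp: less_eq_var_def less_var_def var_index_inject)

end

type_synonym expo = "var \<Rightarrow>\<^sub>0 nat"

abbreviation "lookup \<equiv> Poly_Mapping.lookup"
abbreviation "keys \<equiv> Poly_Mapping.keys"
abbreviation "single \<equiv> Poly_Mapping.single"

section \<open>Coefficients of products\<close>

lemma poly_mapping_sum_single: "(\<Sum>a\<in>keys p. single a (lookup p a)) = p"
proof (rule poly_mapping_eqI)
  fix k
  have "lookup (\<Sum>a\<in>keys p. single a (lookup p a)) k =
      (\<Sum>a\<in>keys p. if k = a then lookup p a else 0)"
    by (simp add: lookup_sum lookup_single when_def eq_commute)
  then show "lookup (\<Sum>a\<in>keys p. single a (lookup p a)) k = lookup p k"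
    by (simp add: in_keys_iff)
qed

lemma lookup_mult_keys:
  fixes f g :: "'a::monoid_add \<Rightarrow>\<^sub>0 'b::semiring_0"
  shows "lookup (f * g) k =
    (\<Sum>(a, b)\<in>keys f \<times> keys g. if a + b = k then lookup f a * lookup g b else 0)"
proof -
  have inner: "(\<Sum>q. lookup g q when k = l + q) =
      (\<Sum>b\<in>keys g. if l + b = k then lookup g b else 0)" for l
    by (subst Sum_any.expand_superset[of "keys g"])
       (auto simp: when_def in_keys_iff intro!: sum.cong)
  have "lookup (f * g) k = (\<Sum>a\<in>keys f. lookup f a *
      (\<Sum>b\<in>keys g. if a + b = k then lookup g b else 0))"
    unfolding lookup_mult inner
    by (subst Sum_any.expand_superset[of "keys f"]) (auto simp: in_keys_iff)
  also have "\<dots> = (\<Sum>a\<in>keys f. \<Sum>b\<in>keys g. if a + b = k then lookup f a * lookup g b else 0)"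
    by (simp add: sum_distrib_left if_distrib cong: if_cong)
  finally show ?thesis
    by (simp add: sum.cartesian_product)
qed

text \<open>No cancellation can occur at \<open>a + b\<close> when the supports offer only one
  decomposition of it. This is the leading-term device behind
  \<open>mon_ideal_cancel\<close>.\<close>

lemma lookup_mult_unique:
  fixes f g :: "'a::monoid_add \<Rightarrow>\<^sub>0 'b::semiring_0"
  assumes "\<And>a' b'. a' \<in> keys f \<Longrightarrow> b' \<in> keys g \<Longrightarrow> a' + b' = a + b \<Longrightarrow> a' = a \<and> b' = b"
  shows "lookup (f * g) (a + b) = lookup f a * lookup g b"
proof -
  have "lookup (f * g) (a + b) = (\<Sum>p\<in>keys f \<times> keys g.
      if p = (a, b) then lookup f a * lookup g b else 0)"
    unfolding lookup_mult_keys by (rule sum.cong) (use assms in \<open>auto split: if_splits\<close>)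
  then show ?thesis
    by (auto simp: in_keys_iff)
qed

section \<open>Sets of exponents and monomial ideals\<close>

definition upset :: "expo set \<Rightarrow> bool" where
  "upset S \<longleftrightarrow> (\<forall>a\<in>S. \<forall>b. a + b \<in> S)"

text \<open>For an upset \<open>S\<close> this means that \<open>mon_ideal S\<close> is extended
  from the polynomial ring in the variables of \<open>W\<close>; variables outside \<open>W\<close>
  are then free modulo it.\<close>

definition determined :: "var set \<Rightarrow> expo set \<Rightarrow> bool" where
  "determined W S \<longleftrightarrow> (\<forall>a b. (\<forall>i\<in>W. lookup a i = lookup b i) \<longrightarrow> a \<in> S \<longrightarrow> b \<in> S)"

text \<open>\<open>mon_ideal (meets W)\<close> is the prime ideal generated by the variables in
  \<open>W\<close>.\<close>

definition meets :: "var set \<Rightarrow> expo set" where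
  "meets W = {a. \<exists>i\<in>W. lookup a i \<noteq> 0}"

definition mon_ideal :: "expo set \<Rightarrow> 'k::comm_ring_1 poly5 set" where
  "mon_ideal S = {p. keys p \<subseteq> S}"

lemma upsetD: "upset S \<Longrightarrow> a \<in> S \<Longrightarrow> a + b \<in> S"
  by (simp add: upset_def)

lemma upsetD': "upset S \<Longrightarrow> b \<in> S \<Longrightarrow> a + b \<in> S"
  by (metis add.commute upset_def)

lemma upset_lookup_le:
  assumes "upset S" "a \<in> S" "\<And>i. lookup a i \<le> lookup b i"
  shows "b \<in> S"
proof -
  have "b = a + (b - a)"
    by (rule poly_mapping_eqI) (use assms in \<open>simp add: lookup_add lookup_minus\<close>)
  then show ?thesis
    using assms upsetD by metis
qed

lemma determined_iff:
  "determined W S \<Longrightarrow> (\<And>i. i \<in> W \<Longrightarrow> lookup a i = lookup b i) \<Longrightarrow> a \<in> S \<longleftrightarrow> b \<in> S"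
  unfolding determined_def by metis

lemma upset_meets: "upset (meets W)"
  by (auto simp: upset_def meets_def lookup_add)

lemma determined_meets: "determined W (meets W)"
  by (auto simp: determined_def meets_def)

lemma upset_Int: "upset S \<Longrightarrow> upset T \<Longrightarrow> upset (S \<inter> T)"
  by (auto simp: upset_def)

lemma upset_INT: "(\<And>i. i \<in> F \<Longrightarrow> upset (S i)) \<Longrightarrow> upset (\<Inter>i\<in>F. S i)"
  by (auto simp: upset_def)

lemma mon_ideal_INT: "mon_ideal (\<Inter>i\<in>F. S i) = (\<Inter>i\<in>F. mon_ideal (S i))"
  by (auto simp: mon_ideal_def)

lemma mon_ideal_mono: "S \<subseteq> T \<Longrightarrow> mon_ideal S \<subseteq> mon_ideal T"
  by (auto simp: mon_ideal_def)

lemma mult_in_mon_ideal: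
  assumes "keys p \<subseteq> S" "keys q \<subseteq> T" "\<And>a b. a \<in> S \<Longrightarrow> b \<in> T \<Longrightarrow> a + b \<in> R"
  shows "p * q \<in> mon_ideal R"
  using assms keys_mult[of p q] unfolding mon_ideal_def by blast

lemma is_ideal_mon_ideal:
  assumes "upset S"
  shows "is_ideal (mon_ideal S :: 'k::comm_ring_1 poly5 set)"
  unfolding is_ideal_def
proof (intro conjI ballI allI)
  fix a b :: "'k poly5"
  assume "a \<in> mon_ideal S" "b \<in> mon_ideal S"
  then show "a + b \<in> mon_ideal S"
    using keys_add[of a b] by (auto simp: mon_ideal_def)
next
  fix r a :: "'k poly5"
  assume "a \<in> mon_ideal S"
  then show "r * a \<in> mon_ideal S"
    by (intro mult_in_mon_ideal[of _ UNIV _ S])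
       (use assms in \<open>auto simp: mon_ideal_def intro: upsetD'\<close>)
qed (simp add: mon_ideal_def)

lemma monomial_in_mon_ideal [simp]: "(monomial5 a :: 'k::comm_ring_1 poly5) \<in> mon_ideal S \<longleftrightarrow> a \<in> S"
  by (simp add: monomial5_def mon_ideal_def)

lemma monomial_mult: "monomial5 a * monomial5 b = monomial5 (a + b)"
  by (simp add: monomial5_def mult_single)

lemma varp_conv_monomial: "varp i = monomial5 (single i 1)"
  by (simp add: varp_def monomial5_def)

text \<open>An ideal extended from the variables of \<open>W\<close> has its associated primes
  inside the prime of \<open>W\<close>, so \<open>s\<close> is a nonzerodivisor. Concretely, take
  the terms of \<open>f\<close> outside \<open>S\<close> of least degree in \<open>W\<close> and the
  terms of \<open>s\<close> without variables of \<open>W\<close>. The sum of their lexicographic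
  maxima arises in only one way, and it stays outside \<open>S\<close> because the term of
  \<open>s\<close> does not touch \<open>W\<close>.\<close>

lemma mon_ideal_cancel:
  fixes s f :: "'k::idom poly5"
  assumes up: "upset S" and det: "determined W S"
    and s: "s \<notin> mon_ideal (meets W)" and sf: "s * f \<in> mon_ideal S"
  shows "f \<in> mon_ideal S"
proof (rule ccontr)
  assume "f \<notin> mon_ideal S"
  define A where "A = keys f - S"
  define wt :: "expo \<Rightarrow> nat" where "wt a = (\<Sum>i\<in>W. lookup a i)" for a
  have wt_add: "wt (a + b) = wt a + wt b" for a b
    by (simp add: wt_def lookup_add sum.distrib)
  have A: "finite A" "A \<noteq> {}"
    using \<open>f \<notin> mon_ideal S\<close> by (auto simp: A_def mon_ideal_def)
  define n where "n = Min (wt ` A)"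
  define A0 where "A0 = {a \<in> A. wt a = n}"
  have n: "n \<le> wt a" if "a \<in> A" for a
    using that A by (simp add: n_def)
  have "n \<in> wt ` A"
    unfolding n_def using A by (intro Min_in) auto
  then have A0: "finite A0" "A0 \<noteq> {}"
    using A by (auto simp: A0_def)
  define B0 where "B0 = keys s - meets W"
  have B0: "finite B0" "B0 \<noteq> {}"
    using s by (auto simp: B0_def mon_ideal_def)
  have wt_0: "wt b = 0 \<longleftrightarrow> b \<notin> meets W" for b
    by (simp add: wt_def meets_def)
  define a where "a = Max A0"
  define b where "b = Max B0"
  have ab: "a \<in> A0" "b \<in> B0"
    using A0 B0 by (auto simp: a_def b_def)
  have "b + a \<in> S \<longleftrightarrow> a \<in> S"
    by (rule determined_iff[OF det]) (use ab in \<open>auto simp: B0_def meets_def lookup_add\<close>)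
  then have notin: "b + a \<notin> S"
    using ab by (auto simp: A0_def A_def)
  have "lookup (s * f) (b + a) = lookup s b * lookup f a"
  proof (rule lookup_mult_unique)
    fix b' a' assume b': "b' \<in> keys s" and a': "a' \<in> keys f" and eq: "b' + a' = b + a"
    have "a' \<notin> S"
      using notin eq up upsetD' by metis
    then have "a' \<in> A" using a' by (simp add: A_def)
    have "wt b' + wt a' = wt b + wt a"
      using eq wt_add by metis
    moreover have "wt b = 0" "wt a = n"
      using ab wt_0 by (auto simp: A0_def B0_def)
    ultimately have "wt b' = 0" "wt a' = n"
      using n[OF \<open>a' \<in> A\<close>] by auto
    then have "b' \<in> B0" "a' \<in> A0"
      using b' \<open>a' \<in> A\<close> wt_0 by (auto simp: A0_def B0_def)
    then have "b' \<le> b" "a' \<le> a"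
      using A0 B0 by (auto simp: a_def b_def)
    then show "b' = b \<and> a' = a"
      using eq by (metis add_le_cancel_left add_le_cancel_right antisym)
  qed
  also have "\<dots> \<noteq> 0"
    using ab by (simp add: A0_def A_def B0_def in_keys_iff)
  finally show False
    using sf notin by (auto simp: mon_ideal_def in_keys_iff)
qed

section \<open>Ideals\<close>

lemma is_ideal_add: "is_ideal J \<Longrightarrow> a \<in> J \<Longrightarrow> b \<in> J \<Longrightarrow> a + b \<in> J"
  by (simp add: is_ideal_def)

lemma is_ideal_mult: "is_ideal J \<Longrightarrow> a \<in> J \<Longrightarrow> r * a \<in> J"
  by (simp add: is_ideal_def)

lemma is_ideal_diff: "is_ideal J \<Longrightarrow> a \<in> J \<Longrightarrow> b \<in> J \<Longrightarrow> a - b \<in> J"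
  unfolding is_ideal_def by (metis diff_conv_add_uminus mult_minus1)

lemma is_ideal_sum: "is_ideal J \<Longrightarrow> (\<And>i. i \<in> A \<Longrightarrow> f i \<in> J) \<Longrightarrow> sum f A \<in> J"
  by (induction A rule: infinite_finite_induct) (auto simp: is_ideal_def)

lemma subset_ideal_gen: "S \<subseteq> ideal_gen S"
proof
  fix s assume "s \<in> S"
  then show "s \<in> ideal_gen S"
    unfolding ideal_gen_def by (intro CollectI exI[of _ "{s}"] exI[of _ "\<lambda>_. 1"]) auto
qed

lemma ideal_gen_least: "is_ideal I \<Longrightarrow> S \<subseteq> I \<Longrightarrow> ideal_gen S \<subseteq> I"
  unfolding ideal_gen_def by (auto intro!: is_ideal_sum simp: is_ideal_def subset_iff)

lemma is_ideal_ideal_gen: "is_ideal (ideal_gen S)"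
  unfolding is_ideal_def
proof (intro conjI ballI allI)
  show "0 \<in> ideal_gen S"
    unfolding ideal_gen_def by (intro CollectI exI[of _ "{}"]) auto
next
  fix a b assume "a \<in> ideal_gen S" "b \<in> ideal_gen S"
  then obtain F G r q where
    F: "finite F" "F \<subseteq> S" "a = (\<Sum>s\<in>F. r s * s)" and
    G: "finite G" "G \<subseteq> S" "b = (\<Sum>s\<in>G. q s * s)"
    unfolding ideal_gen_def by auto
  have "a = (\<Sum>s\<in>F \<union> G. (if s \<in> F then r s else 0) * s)"
    unfolding F(3) using F(1) G(1) by (intro sum.mono_neutral_cong_left) auto
  moreover have "b = (\<Sum>s\<in>F \<union> G. (if s \<in> G then q s else 0) * s)"
    unfolding G(3) using F(1) G(1) by (intro sum.mono_neutral_cong_left) auto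
  ultimately have "a + b =
      (\<Sum>s\<in>F \<union> G. ((if s \<in> F then r s else 0) + (if s \<in> G then q s else 0)) * s)"
    by (simp add: sum.distrib distrib_right)
  then show "a + b \<in> ideal_gen S"
    unfolding ideal_gen_def using F G
    by (intro CollectI exI[of _ "F \<union> G"]
         exI[of _ "\<lambda>s. (if s \<in> F then r s else 0) + (if s \<in> G then q s else 0)"]) auto
next
  fix r a assume "a \<in> ideal_gen S"
  then obtain F q where F: "finite F" "F \<subseteq> S" "a = (\<Sum>s\<in>F. q s * s)"
    unfolding ideal_gen_def by auto
  have "r * a = (\<Sum>s\<in>F. (r * q s) * s)"
    by (simp add: F sum_distrib_left mult.assoc)
  then show "r * a \<in> ideal_gen S"
    unfolding ideal_gen_def using F
    by (intro CollectI exI[of _ F] exI[of _ "\<lambda>s. r * q s"]) auto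
qed

lemma ideal_gen_ideal: "is_ideal J \<Longrightarrow> ideal_gen J = J"
  by (simp add: ideal_gen_least subset_antisym subset_ideal_gen)

lemma ideal_gen_insert:
  assumes "is_ideal J"
  shows "g \<in> ideal_gen (insert f J) \<longleftrightarrow> (\<exists>h. g - h * f \<in> J)"
proof
  let ?K = "{g. \<exists>h. g - h * f \<in> J}"
  have "is_ideal ?K"
    unfolding is_ideal_def
  proof (intro conjI ballI allI; (elim CollectE exE)?)
    show "0 \<in> ?K"
      using assms by (auto simp: is_ideal_def intro!: exI[of _ 0])
  next
    fix a b h k assume "a - h * f \<in> J" "b - k * f \<in> J"
    then have "(a - h * f) + (b - k * f) \<in> J"
      using assms by (simp add: is_ideal_def)
    also have "(a - h * f) + (b - k * f) = a + b - (h + k) * f"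
      by (simp add: algebra_simps)
    finally show "a + b \<in> ?K" by blast
  next
    fix r a h assume "a - h * f \<in> J"
    then have "r * (a - h * f) \<in> J"
      using assms by (simp add: is_ideal_def)
    also have "r * (a - h * f) = r * a - (r * h) * f"
      by (simp add: algebra_simps)
    finally show "r * a \<in> ?K" by blast
  qed
  moreover have "insert f J \<subseteq> ?K"
    using assms by (auto simp: is_ideal_def intro: exI[of _ 1] exI[of _ 0])
  moreover assume "g \<in> ideal_gen (insert f J)"
  ultimately show "\<exists>h. g - h * f \<in> J"
    using ideal_gen_least by blast
next
  assume "\<exists>h. g - h * f \<in> J"
  then obtain h where "g - h * f \<in> J" ..
  moreover have I: "is_ideal (ideal_gen (insert f J))"
    by (rule is_ideal_ideal_gen)
  moreover have "insert f J \<subseteq> ideal_gen (insert f J)"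
    by (rule subset_ideal_gen)
  ultimately have "(g - h * f) + h * f \<in> ideal_gen (insert f J)"
    unfolding is_ideal_def by blast
  then show "g \<in> ideal_gen (insert f J)" by simp
qed

lemma mon_ideal_eq_ideal_gen:
  assumes "upset S"
  shows "mon_ideal S = (ideal_gen (monomial5 ` S) :: 'k::comm_ring_1 poly5 set)"
proof
  show "ideal_gen (monomial5 ` S) \<subseteq> (mon_ideal S :: 'k poly5 set)"
    by (rule ideal_gen_least[OF is_ideal_mon_ideal[OF assms]]) auto
  show "mon_ideal S \<subseteq> (ideal_gen (monomial5 ` S) :: 'k poly5 set)"
  proof
    fix p :: "'k poly5" assume p: "p \<in> mon_ideal S"
    have "(\<Sum>a\<in>keys p. single 0 (lookup p a) * monomial5 a) \<in> ideal_gen (monomial5 ` S)"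
    proof (rule is_ideal_sum[OF is_ideal_ideal_gen])
      fix a assume "a \<in> keys p"
      then have "monomial5 a \<in> ideal_gen (monomial5 ` S :: 'k poly5 set)"
        using p subset_ideal_gen[of "monomial5 ` S"] by (auto simp: mon_ideal_def)
      then show "single 0 (lookup p a) * monomial5 a \<in> ideal_gen (monomial5 ` S)"
        using is_ideal_ideal_gen unfolding is_ideal_def by blast
    qed
    then show "p \<in> ideal_gen (monomial5 ` S)"
      by (simp add: monomial5_def mult_single poly_mapping_sum_single)
  qed
qed

section \<open>Prime ideals over intersections and monomial primes\<close>

lemma prime_ideal_INT_subset:
  assumes Q: "prime_ideal Q" and "finite F" and "\<And>i. i \<in> F \<Longrightarrow> is_ideal (I i)"
    and "(\<Inter>i\<in>F. I i) \<subseteq> Q"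
  shows "\<exists>i\<in>F. I i \<subseteq> Q"
  using assms(2-)
proof (induction F rule: finite_induct)
  case empty
  then show ?case using Q by (auto simp: prime_ideal_def)
next
  case (insert j F)
  show ?case
  proof (cases "I j \<subseteq> Q")
    case False
    then obtain a where a: "a \<in> I j" "a \<notin> Q" by blast
    have "(\<Inter>i\<in>F. I i) \<subseteq> Q"
    proof
      fix b assume b: "b \<in> (\<Inter>i\<in>F. I i)"
      have "b * a \<in> I j"
        using insert.prems(1)[of j] a unfolding is_ideal_def by blast
      moreover have "a * b \<in> I i" if "i \<in> F" for i
        using insert.prems(1)[of i] b that unfolding is_ideal_def by blast
      ultimately have "a * b \<in> Q"
        using insert.prems(2) by (auto simp: mult.commute)
      then show "b \<in> Q"
        using Q a unfolding prime_ideal_def by blast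
    qed
    then show ?thesis
      using insert.IH insert.prems(1) by auto
  qed blast
qed

lemma prime_ideal_power: "prime_ideal P \<Longrightarrow> a ^ n \<in> P \<Longrightarrow> a \<in> P"
  by (induction n) (auto simp: prime_ideal_def)

lemma one_notin_mon_ideal_meets: "1 \<notin> mon_ideal (meets W)"
  by (auto simp: mon_ideal_def meets_def)

lemma prime_mon_ideal_meets: "prime_ideal (mon_ideal (meets W) :: 'k::idom poly5 set)"
  unfolding prime_ideal_def
proof (intro conjI allI impI)
  show "1 \<notin> (mon_ideal (meets W) :: 'k poly5 set)"
    by (rule one_notin_mon_ideal_meets)
  show "a \<in> mon_ideal (meets W) \<or> b \<in> mon_ideal (meets W)"
    if "a * b \<in> mon_ideal (meets W)" for a b :: "'k poly5"
    using mon_ideal_cancel[OF upset_meets determined_meets _ that] by blast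
qed (rule is_ideal_mon_ideal[OF upset_meets])

section \<open>Powers and symbolic powers of monomial ideals\<close>

text \<open>Exponents of the power of a monomial ideal. Starting from \<open>UNIV\<close>, the unit
  ideal, makes every power an upset, whatever \<open>S\<close> is.\<close>

primrec sumset_pow :: "expo set \<Rightarrow> nat \<Rightarrow> expo set" where
  "sumset_pow S 0 = UNIV"
| "sumset_pow S (Suc t) = {a + b | a b. a \<in> S \<and> b \<in> sumset_pow S t}"

lemma upset_sumset_pow: "upset (sumset_pow S t)"
proof (induction t)
  case (Suc t)
  show ?case
    unfolding upset_def
  proof (intro ballI allI)
    fix c d assume "c \<in> sumset_pow S (Suc t)"
    then obtain a b where ab: "a \<in> S" "b \<in> sumset_pow S t" "c = a + b" by auto
    then have "b + d \<in> sumset_pow S t"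
      using Suc by (simp add: upset_def)
    then show "c + d \<in> sumset_pow S (Suc t)"
      using ab by (auto simp: add.assoc)
  qed
qed (simp add: upset_def)

definition restr :: "var set \<Rightarrow> expo \<Rightarrow> expo" where
  "restr W a = Abs_poly_mapping (\<lambda>i. if i \<in> W then lookup a i else 0)"

lemma lookup_restr: "lookup (restr W a) i = (if i \<in> W then lookup a i else 0)"
  unfolding restr_def by (subst lookup_Abs_poly_mapping) auto

text \<open>Erasing the variables outside \<open>W\<close> is additive and preserves
  \<open>S\<close>, so it carries a decomposition of \<open>a\<close> to one of
  \<open>restr W a\<close>; any \<open>b\<close> agreeing with \<open>a\<close> on \<open>W\<close>
  lies above that.\<close>

lemma determined_sumset_pow:
  assumes "determined W S"
  shows "determined W (sumset_pow S t)"
proof -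
  have restr_S: "restr W a \<in> S" if "a \<in> S" for a
    using that determined_iff[OF assms, of a "restr W a"] by (simp add: lookup_restr)
  have restr_pow: "restr W a \<in> sumset_pow S t" if "a \<in> sumset_pow S t" for a
    using that
  proof (induction t arbitrary: a)
    case (Suc t)
    then obtain b c where bc: "b \<in> S" "c \<in> sumset_pow S t" "a = b + c" by auto
    have "restr W a = restr W b + restr W c"
      by (rule poly_mapping_eqI) (simp add: bc lookup_restr lookup_add)
    then show ?case
      using bc Suc.IH restr_S by auto
  qed auto
  show ?thesis
    unfolding determined_def
  proof (intro allI impI)
    fix a b assume eq: "\<forall>i\<in>W. lookup a i = lookup b i" and a: "a \<in> sumset_pow S t"
    show "b \<in> sumset_pow S t"
      by (rule upset_lookup_le[OF upset_sumset_pow restr_pow[OF a]])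
         (use eq in \<open>simp add: lookup_restr\<close>)
  qed
qed

lemma prod_list_in_mon_ideal:
  "set fs \<subseteq> mon_ideal S \<Longrightarrow> prod_list fs \<in> mon_ideal (sumset_pow S (length fs))"
proof (induction fs)
  case Nil
  then show ?case by (simp add: mon_ideal_def)
next
  case (Cons f fs)
  then have "prod_list fs \<in> mon_ideal (sumset_pow S (length fs))" "f \<in> mon_ideal S"
    by auto
  then show ?case
    unfolding prod_list.Cons list.size
    by (intro mult_in_mon_ideal[of _ S _ "sumset_pow S (length fs)"]) (auto simp: mon_ideal_def)
qed

lemma ideal_pow_mon_ideal_subset: "ideal_pow (mon_ideal S) t \<subseteq> mon_ideal (sumset_pow S t)"
  unfolding ideal_pow_def
  by (rule ideal_gen_least[OF is_ideal_mon_ideal[OF upset_sumset_pow]])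
     (auto simp: prod_list_in_mon_ideal)

text \<open>The \<open>t\<close> copies of \<open>c\<close> are distributed, one to each of the
  \<open>t\<close> summands of \<open>a\<close>, which moves every summand from \<open>S\<close> to
  \<open>T\<close>.\<close>

lemma monomial_in_ideal_pow:
  assumes "\<And>a. a \<in> S \<Longrightarrow> c + a \<in> T" and "a \<in> sumset_pow S t"
  shows "monomial5 c ^ t * monomial5 a \<in> ideal_pow (mon_ideal T :: 'k::comm_ring_1 poly5 set) t"
proof -
  have "\<exists>fs r. length fs = t \<and> set fs \<subseteq> mon_ideal T \<and>
      monomial5 c ^ t * (monomial5 a :: 'k poly5) = r * prod_list fs"
    using assms(2)
  proof (induction t arbitrary: a)
    case 0
    then show ?case by auto
  next
    case (Suc t)
    then obtain b d where bd: "b \<in> S" "d \<in> sumset_pow S t" "a = b + d" by auto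
    obtain fs r where fs: "length fs = t" "set fs \<subseteq> mon_ideal T"
      "monomial5 c ^ t * (monomial5 d :: 'k poly5) = r * prod_list fs"
      using Suc.IH[OF bd(2)] by blast
    have "monomial5 c ^ Suc t * (monomial5 a :: 'k poly5) =
        monomial5 (c + b) * (monomial5 c ^ t * monomial5 d)"
      by (simp add: bd monomial_mult[symmetric] mult_ac)
    also have "\<dots> = r * prod_list (monomial5 (c + b) # fs)"
      unfolding fs(3) prod_list.Cons by (rule mult.left_commute)
    finally show ?case
      using fs assms(1)[OF bd(1)]
      by (intro exI[of _ "monomial5 (c + b) # fs"] exI[of _ r]) auto
  qed
  then obtain fs r where fs: "length fs = t" "set fs \<subseteq> mon_ideal T"
    "monomial5 c ^ t * (monomial5 a :: 'k poly5) = r * prod_list fs" by blast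
  then have "prod_list fs \<in> {prod_list fs | fs. length fs = t \<and> set fs \<subseteq> mon_ideal T}"
    by blast
  then have "prod_list fs \<in> ideal_pow (mon_ideal T) t"
    unfolding ideal_pow_def by (rule subsetD[OF subset_ideal_gen])
  then show ?thesis
    unfolding fs(3) ideal_pow_def by (rule is_ideal_mult[OF is_ideal_ideal_gen])
qed

text \<open>\<open>T\<close> and \<open>S\<close> define the same ideal once the monomial of
  \<open>c\<close> is inverted, and that monomial is a unit at the prime of \<open>W\<close>. The
  inclusion from left to right is \<open>mon_ideal_cancel\<close>; for the other one the multiplier
  is the \<open>t\<close>-th power of the monomial.\<close>

lemma primary_component_mon_ideal:
  assumes S: "upset S" "determined W S" and "T \<subseteq> S"
    and c: "c \<notin> meets W" "\<And>a. a \<in> S \<Longrightarrow> c + a \<in> T"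
  shows "primary_component_at (ideal_pow (mon_ideal T) t) (mon_ideal (meets W)) =
    (mon_ideal (sumset_pow S t) :: 'k::idom poly5 set)"
proof
  have "ideal_pow (mon_ideal T) t \<subseteq> (mon_ideal (sumset_pow T t) :: 'k poly5 set)"
    by (rule ideal_pow_mon_ideal_subset)
  also have "sumset_pow T t \<subseteq> sumset_pow S t"
    using \<open>T \<subseteq> S\<close> by (induction t) auto
  then have "mon_ideal (sumset_pow T t) \<subseteq> (mon_ideal (sumset_pow S t) :: 'k poly5 set)"
    by (rule mon_ideal_mono)
  finally show "primary_component_at (ideal_pow (mon_ideal T) t) (mon_ideal (meets W)) \<subseteq>
      (mon_ideal (sumset_pow S t) :: 'k poly5 set)"
    unfolding primary_component_at_def
    using mon_ideal_cancel[OF upset_sumset_pow determined_sumset_pow[OF S(2)]] by blast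
next
  show "(mon_ideal (sumset_pow S t) :: 'k poly5 set) \<subseteq>
      primary_component_at (ideal_pow (mon_ideal T) t) (mon_ideal (meets W))"
  proof
    fix f :: "'k poly5" assume f: "f \<in> mon_ideal (sumset_pow S t)"
    let ?s = "monomial5 c ^ t :: 'k poly5"
    have "?s \<notin> mon_ideal (meets W)"
      using prime_ideal_power[OF prime_mon_ideal_meets] c(1) by fastforce
    moreover have "?s * f \<in> ideal_pow (mon_ideal T) t"
    proof -
      have I: "is_ideal (ideal_pow (mon_ideal T :: 'k poly5 set) t)"
        unfolding ideal_pow_def by (rule is_ideal_ideal_gen)
      have "?s * (\<Sum>a\<in>keys f. single 0 (lookup f a) * monomial5 a) =
          (\<Sum>a\<in>keys f. single 0 (lookup f a) * (?s * monomial5 a))"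
        by (simp add: sum_distrib_left mult_ac)
      also have "\<dots> \<in> ideal_pow (mon_ideal T) t"
      proof (rule is_ideal_sum[OF I])
        fix a assume "a \<in> keys f"
        then have "?s * monomial5 a \<in> ideal_pow (mon_ideal T) t"
          using f c(2) by (intro monomial_in_ideal_pow[of S]) (auto simp: mon_ideal_def)
        then show "single 0 (lookup f a) * (?s * monomial5 a) \<in> ideal_pow (mon_ideal T) t"
          using I unfolding is_ideal_def by blast
      qed
      finally show ?thesis
        by (simp add: monomial5_def mult_single poly_mapping_sum_single)
    qed
    ultimately show "f \<in> primary_component_at (ideal_pow (mon_ideal T) t) (mon_ideal (meets W))"
      unfolding primary_component_at_def by blast
  qed
qed

lemma mon_ideal_meets_subset_prime:
  assumes Q: "prime_ideal Q" and var: "\<And>i. i \<in> W \<Longrightarrow> varp i \<in> Q"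
  shows "mon_ideal (meets W) \<subseteq> Q"
proof -
  have I: "is_ideal Q" using Q by (simp add: prime_ideal_def)
  have "monomial5 a \<in> Q" if a: "a \<in> meets W" for a
  proof -
    obtain i where i: "i \<in> W" "lookup a i \<noteq> 0"
      using a by (auto simp: meets_def)
    have "a = (a - single i 1) + single i 1"
      by (rule poly_mapping_eqI) (use i in \<open>auto simp: lookup_add lookup_minus lookup_single when_def\<close>)
    then have "monomial5 a = monomial5 (a - single i 1) * varp i"
      by (metis monomial_mult varp_conv_monomial)
    then show ?thesis
      using I var[OF i(1)] unfolding is_ideal_def by metis
  qed
  then show ?thesis
    unfolding mon_ideal_eq_ideal_gen[OF upset_meets] using I by (intro ideal_gen_least) auto
qed

lemma monomial_single_power: "monomial5 (single i n) = varp i ^ n"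
proof (induction n)
  case (Suc n)
  have "single i (Suc n) = single i 1 + single i n"
    by (simp add: single_add[symmetric])
  then show ?case
    by (simp only: power_Suc Suc[symmetric]) (simp only: varp_conv_monomial monomial_mult)
qed (simp add: monomial5_def)

text \<open>A prime over the intersection contains one component, hence the pure powers in it, hence
  the variables of its \<open>W\<close>. Minimality of these primes is the antichain
  condition.\<close>

lemma minimal_primes_mon_ideal:
  assumes "finite \<W>"
    and up: "\<And>W. W \<in> \<W> \<Longrightarrow> upset (S W)"
    and sub: "\<And>W. W \<in> \<W> \<Longrightarrow> S W \<subseteq> meets W"
    and pow: "\<And>W i. W \<in> \<W> \<Longrightarrow> i \<in> W \<Longrightarrow> single i N \<in> S W"
    and anti: "\<And>W W'. W \<in> \<W> \<Longrightarrow> W' \<in> \<W> \<Longrightarrow> W \<subseteq> W' \<Longrightarrow> W = W'"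
  shows "minimal_primes (mon_ideal (\<Inter>W\<in>\<W>. S W) :: 'k::idom poly5 set) =
    (\<lambda>W. mon_ideal (meets W)) ` \<W>"
proof -
  let ?I = "mon_ideal (\<Inter>W\<in>\<W>. S W) :: 'k poly5 set"
  let ?P = "\<lambda>W. mon_ideal (meets W) :: 'k poly5 set"
  have over: "\<exists>W\<in>\<W>. ?P W \<subseteq> Q" if Q: "prime_ideal Q" "?I \<subseteq> Q" for Q
  proof -
    have "\<exists>W\<in>\<W>. mon_ideal (S W) \<subseteq> Q"
      by (rule prime_ideal_INT_subset[OF Q(1) \<open>finite \<W>\<close>])
         (use Q(2) is_ideal_mon_ideal[OF up] in \<open>auto simp: mon_ideal_INT\<close>)
    then obtain W where W: "W \<in> \<W>" "mon_ideal (S W) \<subseteq> Q" by blast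
    have "varp i \<in> Q" if "i \<in> W" for i
    proof (rule prime_ideal_power[OF Q(1)])
      have "varp i ^ N \<in> mon_ideal (S W)"
        unfolding monomial_single_power[symmetric] using pow[OF W(1) that] by simp
      then show "varp i ^ N \<in> Q" using W by blast
    qed
    then show ?thesis
      using W(1) mon_ideal_meets_subset_prime[OF Q(1)] by blast
  qed
  have inj: "W \<subseteq> W'" if "?P W \<subseteq> ?P W'" for W W'
  proof
    fix i assume "i \<in> W"
    then have "monomial5 (single i 1) \<in> ?P W"
      by (auto simp: meets_def intro!: bexI[of _ i])
    then have "monomial5 (single i 1) \<in> ?P W'" using that by blast
    then show "i \<in> W'"
      by (auto simp: meets_def lookup_single when_def split: if_splits)
  qed
  have sup: "?I \<subseteq> ?P W" if "W \<in> \<W>" for W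
    using sub[OF that] that by (intro mon_ideal_mono) auto
  show ?thesis
  proof
    show "minimal_primes ?I \<subseteq> ?P ` \<W>"
    proof
      fix Q assume "Q \<in> minimal_primes ?I"
      then have Q: "prime_ideal Q" "?I \<subseteq> Q"
        "\<And>Q'. prime_ideal Q' \<Longrightarrow> ?I \<subseteq> Q' \<Longrightarrow> \<not> Q' \<subset> Q"
        by (auto simp: minimal_primes_def)
      obtain W where W: "W \<in> \<W>" "?P W \<subseteq> Q"
        using over[OF Q(1,2)] by blast
      then have "?P W = Q"
        using Q(3)[OF prime_mon_ideal_meets sup[OF W(1)]] by blast
      then show "Q \<in> ?P ` \<W>" using W by blast
    qed
    show "?P ` \<W> \<subseteq> minimal_primes ?I"
    proof safe
      fix W assume W: "W \<in> \<W>"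
      have "\<not> Q \<subset> ?P W" if Q: "prime_ideal Q" "?I \<subseteq> Q" for Q
      proof
        assume "Q \<subset> ?P W"
        obtain W' where W': "W' \<in> \<W>" "?P W' \<subseteq> Q"
          using over[OF Q] by blast
        then have "W' \<subseteq> W"
          using \<open>Q \<subset> ?P W\<close> by (intro inj) auto
        then have "W' = W" using anti W W' by blast
        then show False using W' \<open>Q \<subset> ?P W\<close> by blast
      qed
      then show "?P W \<in> minimal_primes ?I"
        unfolding minimal_primes_def
        using prime_mon_ideal_meets sup[OF W] by blast
    qed
  qed
qed

text \<open>The multiplier \<open>c W\<close> avoids the variables of \<open>W\<close> and moves
  \<open>S W\<close> into all other components, so localizing at the prime of \<open>W\<close>
  deletes them.\<close>

lemma symbolic_power_mon_ideal:
  fixes c :: "var set \<Rightarrow> expo"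
  assumes "finite \<W>"
    and up: "\<And>W. W \<in> \<W> \<Longrightarrow> upset (S W)"
    and det: "\<And>W. W \<in> \<W> \<Longrightarrow> determined W (S W)"
    and sub: "\<And>W. W \<in> \<W> \<Longrightarrow> S W \<subseteq> meets W"
    and pow: "\<And>W i. W \<in> \<W> \<Longrightarrow> i \<in> W \<Longrightarrow> single i N \<in> S W"
    and anti: "\<And>W W'. W \<in> \<W> \<Longrightarrow> W' \<in> \<W> \<Longrightarrow> W \<subseteq> W' \<Longrightarrow> W = W'"
    and c: "\<And>W. W \<in> \<W> \<Longrightarrow> c W \<notin> meets W"
      "\<And>W W' a. W \<in> \<W> \<Longrightarrow> W' \<in> \<W> \<Longrightarrow> a \<in> S W \<Longrightarrow> c W + a \<in> S W'"
  shows "symbolic_power (mon_ideal (\<Inter>W\<in>\<W>. S W) :: 'k::idom poly5 set) t =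
    mon_ideal (\<Inter>W\<in>\<W>. sumset_pow (S W) t)"
proof -
  have comp: "primary_component_at (ideal_pow (mon_ideal (\<Inter>W\<in>\<W>. S W)) t) (mon_ideal (meets W)) =
      (mon_ideal (sumset_pow (S W) t) :: 'k poly5 set)" if "W \<in> \<W>" for W
    using that by (intro primary_component_mon_ideal[where c = "c W"] up det c) (auto intro: c(2))
  have "minimal_primes (mon_ideal (\<Inter>W\<in>\<W>. S W) :: 'k poly5 set) =
      (\<lambda>W. mon_ideal (meets W)) ` \<W>"
    by (rule minimal_primes_mon_ideal[of \<W> S N, OF \<open>finite \<W>\<close> up sub pow anti])
  then have "symbolic_power (mon_ideal (\<Inter>W\<in>\<W>. S W) :: 'k poly5 set) t =
      (\<Inter>W\<in>\<W>. mon_ideal (sumset_pow (S W) t))"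
    unfolding symbolic_power_def by (simp add: comp)
  then show ?thesis
    by (simp only: mon_ideal_INT)
qed

section \<open>Upper bounds for the depth from Koszul cocycles\<close>

lemma max_ideal5_coords:
  assumes "f \<in> max_ideal5"
  obtains a where "f = (\<Sum>i\<in>UNIV. a i * varp i)"
proof -
  obtain F r where F: "finite F" "F \<subseteq> range varp" "f = (\<Sum>s\<in>F. r s * s)"
    using assms unfolding max_ideal5_def ideal_gen_def by auto
  have inj: "inj (varp :: var \<Rightarrow> 'a poly5)"
    by (rule injI) (metis keys_single one_neq_zero singleton_inject varp_def)
  have "f = (\<Sum>i\<in>varp -` F. r (varp i) * varp i)"
    unfolding F(3) using F(2)
    by (subst sum.reindex[symmetric, of varp, unfolded comp_def])
       (auto intro: inj_on_subset[OF inj] intro!: sum.cong)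
  also have "\<dots> = (\<Sum>i\<in>UNIV. (if varp i \<in> F then r (varp i) else 0) * varp i)"
    by (rule sum.mono_neutral_cong_left) auto
  finally show ?thesis by (rule that)
qed

lemma max_ideal5_subset: "max_ideal5 \<subseteq> mon_ideal (meets UNIV)"
proof -
  have "single i 1 \<in> meets UNIV" for i
    unfolding meets_def by (rule CollectI, rule bexI[of _ i]) simp_all
  then have "range varp \<subseteq> mon_ideal (meets UNIV)"
    by (simp only: varp_conv_monomial image_subset_iff monomial_in_mon_ideal) simp
  then show ?thesis
    unfolding max_ideal5_def by (rule ideal_gen_least[OF is_ideal_mon_ideal[OF upset_meets]])
qed

lemma regular_seq_Cons_iff:
  assumes "is_ideal J"
  shows "regular_seq M J (f # fs) \<longleftrightarrow>
    f \<in> M \<and> (\<forall>g. g * f \<in> J \<longrightarrow> g \<in> J) \<and> regular_seq M (ideal_gen (insert f J)) fs"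
proof -
  have gen: "ideal_gen (J \<union> insert f A) = ideal_gen (ideal_gen (insert f J) \<union> A)" for A
  proof
    show "ideal_gen (J \<union> insert f A) \<subseteq> ideal_gen (ideal_gen (insert f J) \<union> A)"
      using subset_ideal_gen[of "insert f J"] subset_ideal_gen[of "ideal_gen (insert f J) \<union> A"]
      by (intro ideal_gen_least is_ideal_ideal_gen) auto
    have "ideal_gen (insert f J) \<subseteq> ideal_gen (J \<union> insert f A)"
      using subset_ideal_gen[of "J \<union> insert f A"]
      by (intro ideal_gen_least is_ideal_ideal_gen) auto
    then show "ideal_gen (ideal_gen (insert f J) \<union> A) \<subseteq> ideal_gen (J \<union> insert f A)"
      using subset_ideal_gen[of "J \<union> insert f A"]
      by (intro ideal_gen_least is_ideal_ideal_gen) auto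
  qed
  show ?thesis
    unfolding regular_seq_def
    by (simp only: length_Cons All_less_Suc2 nth_Cons_0 nth_Cons_Suc take_Suc_Cons take_0
        list.set gen Un_empty_right ideal_gen_ideal[OF assms] insert_subset conj_ac)
qed

lemma regular_seq_Nil_iff: "regular_seq M J [] \<longleftrightarrow> 1 \<notin> ideal_gen J"
  by (simp add: regular_seq_def)

text \<open>Contracting \<open>c\<close> with the coordinates of \<open>f1\<close> gives
  \<open>g\<close> with \<open>varp k * g\<close> congruent to \<open>c k * f1\<close>. Thus
  \<open>f2\<close> kills \<open>g\<close> modulo \<open>(J, f1)\<close>, so \<open>g\<close> is a
  multiple \<open>h * f1\<close> modulo \<open>J\<close>; cancelling \<open>f1\<close> exhibits
  \<open>c\<close> as the coboundary of \<open>h\<close>.\<close>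

lemma koszul_1_cocycle_regular_seq:
  fixes c :: "var \<Rightarrow> 'k::comm_ring_1 poly5"
  assumes J: "is_ideal J"
    and cocycle: "\<And>i j. varp j * c i - varp i * c j \<in> J"
    and not_coboundary: "\<And>e. \<exists>i. c i - varp i * e \<notin> J"
    and reg: "regular_seq max_ideal5 J fs"
  shows "length fs < 2"
proof (rule ccontr)
  assume "\<not> length fs < 2"
  then obtain f1 f2 gs where fs: "fs = f1 # f2 # gs"
    by (auto simp: not_less numeral_2_eq_2 Suc_le_length_iff)
  define K where "K = ideal_gen (insert f1 J)"
  have K: "is_ideal K"
    unfolding K_def by (rule is_ideal_ideal_gen)
  have f: "f1 \<in> max_ideal5" "f2 \<in> max_ideal5"
    and reg1: "\<And>g. g * f1 \<in> J \<Longrightarrow> g \<in> J" and reg2: "\<And>g. g * f2 \<in> K \<Longrightarrow> g \<in> K"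
    using reg unfolding fs regular_seq_Cons_iff[OF J] K_def[symmetric] regular_seq_Cons_iff[OF K]
    by blast+
  have K_iff: "g \<in> K \<longleftrightarrow> (\<exists>h. g - h * f1 \<in> J)" for g
    unfolding K_def by (rule ideal_gen_insert[OF J])
  then have KI: "g - h * f1 \<in> J \<Longrightarrow> g \<in> K" for g h
    by blast
  obtain a where a: "f1 = (\<Sum>i\<in>UNIV. a i * varp i)"
    using max_ideal5_coords[OF f(1)] .
  obtain b where b: "f2 = (\<Sum>i\<in>UNIV. b i * varp i)"
    using max_ideal5_coords[OF f(2)] .
  define g where "g = (\<Sum>i\<in>UNIV. a i * c i)"
  have g: "varp k * g - c k * f1 \<in> J" for k
  proof -
    have "varp k * g - c k * f1 = (\<Sum>i\<in>UNIV. a i * (varp k * c i - varp i * c k))"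
      by (simp add: g_def a sum_distrib_left sum_subtractf algebra_simps)
    then show ?thesis
      by (simp add: is_ideal_sum[OF J] is_ideal_mult[OF J cocycle])
  qed
  have "g * f2 \<in> K"
  proof -
    have "g * f2 = (\<Sum>k\<in>UNIV. b k * (varp k * g))"
      by (simp add: b sum_distrib_left algebra_simps)
    also have "\<dots> \<in> K"
      by (intro is_ideal_sum[OF K] is_ideal_mult[OF K] KI[OF g])
    finally show ?thesis .
  qed
  then have "g \<in> K"
    by (rule reg2)
  then obtain h where h: "g - h * f1 \<in> J"
    unfolding K_iff ..
  have "c k - varp k * h \<in> J" for k
  proof (rule reg1)
    have "(c k - varp k * h) * f1 = varp k * (g - h * f1) - (varp k * g - c k * f1)"
      by (simp add: algebra_simps)
    also have "\<dots> \<in> J"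
      by (intro is_ideal_diff[OF J] is_ideal_mult[OF J] h g)
    finally show "(c k - varp k * h) * f1 \<in> J" .
  qed
  then show False using not_coboundary by blast
qed

text \<open>Contraction with \<open>f1\<close> turns \<open>c\<close> into a 1-cocycle
  \<open>d\<close> modulo \<open>K = (J, f1)\<close>. The degree-one argument with \<open>f2\<close>
  and \<open>f3\<close> makes \<open>d\<close> a coboundary modulo \<open>K\<close>, and the
  multiples of \<open>f1\<close> left over form a primitive of \<open>c\<close>.\<close>

lemma koszul_2_cocycle_regular_seq:
  fixes c :: "var \<Rightarrow> var \<Rightarrow> 'k::comm_ring_1 poly5"
  assumes J: "is_ideal J"
    and cocycle: "\<And>i j k. varp k * c i j - varp j * c i k + varp i * c j k \<in> J"
    and not_coboundary: "\<And>e. \<exists>j k. c j k - (varp j * e k - varp k * e j) \<notin> J"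
    and reg: "regular_seq max_ideal5 J fs"
  shows "length fs < 3"
proof (rule ccontr)
  assume "\<not> length fs < 3"
  then obtain f1 f2 f3 gs where fs: "fs = f1 # f2 # f3 # gs"
    by (auto simp: not_less numeral_3_eq_3 Suc_le_length_iff)
  define K where "K = ideal_gen (insert f1 J)"
  define L where "L = ideal_gen (insert f2 K)"
  have K: "is_ideal K"
    unfolding K_def by (rule is_ideal_ideal_gen)
  have L: "is_ideal L"
    unfolding L_def by (rule is_ideal_ideal_gen)
  have f: "f1 \<in> max_ideal5" "f2 \<in> max_ideal5" "f3 \<in> max_ideal5"
    and reg1: "\<And>g. g * f1 \<in> J \<Longrightarrow> g \<in> J" and reg2: "\<And>g. g * f2 \<in> K \<Longrightarrow> g \<in> K"
    and reg3: "\<And>g. g * f3 \<in> L \<Longrightarrow> g \<in> L"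
    using reg unfolding fs regular_seq_Cons_iff[OF J] K_def[symmetric]
      regular_seq_Cons_iff[OF K] L_def[symmetric] regular_seq_Cons_iff[OF L] by blast+
  have K_iff: "g \<in> K \<longleftrightarrow> (\<exists>h. g - h * f1 \<in> J)" for g
    unfolding K_def by (rule ideal_gen_insert[OF J])
  then have KI: "g - h * f1 \<in> J \<Longrightarrow> g \<in> K" for g h
    by blast
  have L_iff: "g \<in> L \<longleftrightarrow> (\<exists>h. g - h * f2 \<in> K)" for g
    unfolding L_def by (rule ideal_gen_insert[OF K])
  then have LI: "g - h * f2 \<in> K \<Longrightarrow> g \<in> L" for g h
    by blast
  obtain a where a: "f1 = (\<Sum>i\<in>UNIV. a i * varp i)"
    using max_ideal5_coords[OF f(1)] .
  obtain b where b: "f2 = (\<Sum>i\<in>UNIV. b i * varp i)"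
    using max_ideal5_coords[OF f(2)] .
  obtain r where r: "f3 = (\<Sum>i\<in>UNIV. r i * varp i)"
    using max_ideal5_coords[OF f(3)] .
  define d where "d j = (\<Sum>i\<in>UNIV. a i * c i j)" for j
  have d: "(varp k * d j - varp j * d k) + c j k * f1 \<in> J" for j k
  proof -
    have "(varp k * d j - varp j * d k) + c j k * f1 =
        (\<Sum>i\<in>UNIV. a i * (varp k * c i j - varp j * c i k + varp i * c j k))"
      by (simp add: d_def a sum_distrib_left sum_subtractf sum.distrib algebra_simps)
    then show ?thesis
      by (simp add: is_ideal_sum[OF J] is_ideal_mult[OF J cocycle])
  qed
  define g where "g = (\<Sum>j\<in>UNIV. b j * d j)"
  have g: "varp k * g - d k * f2 \<in> K" for k
  proof -
    have "varp k * g - d k * f2 = (\<Sum>j\<in>UNIV. b j * (varp k * d j - varp j * d k))"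
      by (simp add: g_def b sum_distrib_left sum_subtractf algebra_simps)
    also have "\<dots> \<in> K"
    proof (intro is_ideal_sum[OF K] is_ideal_mult[OF K])
      fix j
      have "(varp k * d j - varp j * d k) - (- c j k) * f1 \<in> J"
        using d[of k j] by simp
      then show "varp k * d j - varp j * d k \<in> K"
        by (rule KI)
    qed
    finally show ?thesis .
  qed
  have "g * f3 \<in> L"
  proof -
    have "g * f3 = (\<Sum>k\<in>UNIV. r k * (varp k * g))"
      by (simp add: r sum_distrib_left algebra_simps)
    also have "\<dots> \<in> L"
      by (intro is_ideal_sum[OF L] is_ideal_mult[OF L] LI[OF g])
    finally show ?thesis .
  qed
  then have "g \<in> L"
    by (rule reg3)
  then obtain h where h: "g - h * f2 \<in> K"
    unfolding L_iff ..
  have "d k - varp k * h \<in> K" for k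
  proof (rule reg2)
    have "(d k - varp k * h) * f2 = varp k * (g - h * f2) - (varp k * g - d k * f2)"
      by (simp add: algebra_simps)
    also have "\<dots> \<in> K"
      by (intro is_ideal_diff[OF K] is_ideal_mult[OF K] h g)
    finally show "(d k - varp k * h) * f2 \<in> K" .
  qed
  \<comment> \<open>The coefficients of \<open>f1\<close> in this congruence are the primitive:
    substituting them into the relation \<open>d\<close> leaves \<open>f1\<close> times the defect
    of \<open>c\<close>.\<close>
  then obtain e where e: "\<And>k. (d k - varp k * h) - e k * f1 \<in> J"
    unfolding K_iff by metis
  have "c j k - (varp j * e k - varp k * e j) \<in> J" for j k
  proof (rule reg1)
    have "(c j k - (varp j * e k - varp k * e j)) * f1 =
        ((varp k * d j - varp j * d k) + c j k * f1) -
        (varp k * ((d j - varp j * h) - e j * f1) - varp j * ((d k - varp k * h) - e k * f1))"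
      by (simp add: algebra_simps)
    also have "\<dots> \<in> J"
      by (intro is_ideal_diff[OF J] is_ideal_mult[OF J] e d)
    finally show "(c j k - (varp j * e k - varp k * e j)) * f1 \<in> J" .
  qed
  then show False using not_coboundary by blast
qed

section \<open>Regular elements modulo monomial ideals\<close>

definition free_of :: "var \<Rightarrow> 'k::comm_ring_1 poly5 \<Rightarrow> bool" where
  "free_of w p \<longleftrightarrow> (\<forall>a\<in>keys p. lookup a w = 0)"

lemma free_of_zero: "free_of w 0"
  by (simp add: free_of_def)

lemma free_of_one: "free_of w 1"
  by (simp add: free_of_def)

lemma free_of_add: "free_of w p \<Longrightarrow> free_of w q \<Longrightarrow> free_of w (p + q)"
  using keys_add[of p q] unfolding free_of_def by blast

lemma free_of_mult: "free_of w p \<Longrightarrow> free_of w q \<Longrightarrow> free_of w (p * q)"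
  using keys_mult[of p q] unfolding free_of_def by (fastforce simp: lookup_add)

lemma free_of_uminus: "free_of w (- p) \<longleftrightarrow> free_of w p"
  by (simp add: free_of_def in_keys_iff)

lemma free_of_sum: "(\<And>i. i \<in> A \<Longrightarrow> free_of w (f i)) \<Longrightarrow> free_of w (sum f A)"
  by (induction A rule: infinite_finite_induct) (auto intro: free_of_add simp: free_of_zero)

lemma free_of_power: "free_of w p \<Longrightarrow> free_of w (p ^ n)"
  by (induction n) (auto intro: free_of_mult simp: free_of_one)

lemma free_of_varp: "i \<noteq> w \<Longrightarrow> free_of w (varp i)"
  by (auto simp: free_of_def varp_def lookup_single)

text \<open>Multiplying by w a term of e outside S of maximal degree in w gives a term that neither
  e h nor p can cancel.\<close>

lemma mult_var_plus_free_in_mon_ideal: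
  fixes e h p :: "'k::comm_ring_1 poly5"
  assumes S: "upset S" "determined W S" "w \<notin> W"
    and free: "free_of w h" "free_of w p"
    and eq: "e * (varp w + h) - p \<in> mon_ideal S"
  shows "e \<in> mon_ideal S"
proof (rule ccontr)
  assume "e \<notin> mon_ideal S"
  define A where "A = keys e - S"
  have A: "finite A" "A \<noteq> {}"
    using \<open>e \<notin> mon_ideal S\<close> by (auto simp: A_def mon_ideal_def)
  have "Max ((\<lambda>a. lookup a w) ` A) \<in> (\<lambda>a. lookup a w) ` A"
    using A by (intro Max_in) auto
  then obtain a where a: "a \<in> A" "lookup a w = Max ((\<lambda>a. lookup a w) ` A)" by auto
  have max: "lookup b w \<le> lookup a w" if "b \<in> A" for b
    unfolding a(2) using that A by simp
  let ?k = "a + single w 1"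
  have "?k \<in> S \<longleftrightarrow> a \<in> S"
    by (rule determined_iff[OF S(2)]) (use S(3) in \<open>auto simp: lookup_add lookup_single when_def\<close>)
  then have k: "?k \<notin> S"
    using a by (simp add: A_def)
  have "lookup (e * varp w) ?k = lookup e a * lookup (varp w) (single w 1)"
    by (rule lookup_mult_unique) (auto simp: varp_def)
  then have 1: "lookup (e * varp w) ?k = lookup e a"
    by (simp add: varp_def)
  have 2: "lookup (e * h) ?k = 0"
  proof (rule ccontr)
    assume "lookup (e * h) ?k \<noteq> 0"
    then have "?k \<in> keys (e * h)"
      by (rule in_keys_iff[THEN iffD2])
    then obtain b c where bc: "b \<in> keys e" "c \<in> keys h" "?k = b + c"
      using keys_mult[of e h] by blast
    have "lookup c w = 0"
      using free(1) bc(2) by (simp add: free_of_def)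
    then have "lookup b w = Suc (lookup a w)"
      using arg_cong[OF bc(3), of "\<lambda>x. lookup x w"] by (simp add: lookup_add)
    then have "b \<in> S"
      using max[of b] bc(1) by (auto simp: A_def)
    then show False using k upsetD[OF S(1)] unfolding bc(3) by blast
  qed
  have 3: "lookup p ?k = 0"
  proof (rule ccontr)
    assume "lookup p ?k \<noteq> 0"
    then have "lookup ?k w = 0"
      using free(2) by (simp add: free_of_def in_keys_iff)
    then show False by (simp add: lookup_add)
  qed
  have "lookup (e * (varp w + h) - p) ?k = lookup e a"
    using 1 2 3 by (simp add: lookup_minus lookup_add distrib_left)
  also have "\<dots> \<noteq> 0"
    using a by (simp add: A_def in_keys_iff)
  finally show False
    using eq k by (auto simp: mon_ideal_def in_keys_iff)
qed

corollary var_plus_free_regular: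
  fixes h :: "'k::comm_ring_1 poly5"
  assumes "upset S" "determined W S" "w \<notin> W" "free_of w h" "g * (varp w + h) \<in> mon_ideal S"
  shows "g \<in> mon_ideal S"
  using mult_var_plus_free_in_mon_ideal[OF assms(1-4), of 0 g] assms(5)
  by (simp add: free_of_def)

text \<open>Division by \<open>varp w + h\<close>, which is monic in \<open>w\<close>; the remainder
  is the result of substituting \<open>- h\<close> for \<open>w\<close>.\<close>

lemma reduce_to_free:
  fixes h g :: "'k::comm_ring_1 poly5"
  assumes "free_of w h"
  obtains g' q where "free_of w g'" "g = g' + q * (varp w + h)"
proof -
  have mono: "\<exists>g' q. free_of w g' \<and> monomial5 a = g' + q * (varp w + h)" for a
  proof -
    define n where "n = lookup a w"
    define b where "b = a - single w n"
    have a: "a = single w n + b"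
      by (rule poly_mapping_eqI)
         (auto simp: b_def n_def lookup_add lookup_minus lookup_single when_def)
    have b: "free_of w (monomial5 b :: 'k poly5)"
      by (auto simp: free_of_def monomial5_def b_def n_def lookup_minus)
    have "monomial5 a = varp w ^ n * (monomial5 b :: 'k poly5)"
      unfolding a monomial_mult[symmetric] monomial_single_power ..
    moreover have "varp w ^ n - (- h) ^ n = (\<Sum>i<n. (- h) ^ (n - Suc i) * varp w ^ i) * (varp w + h)"
      using power_diff_sumr2[of "varp w" n "- h"] by (simp only: diff_minus_eq_add mult.commute)
    then obtain q where "varp w ^ n - (- h) ^ n = q * (varp w + h)" by blast
    then have "varp w ^ n = (- h) ^ n + q * (varp w + h)"
      by (simp add: algebra_simps)
    ultimately have "monomial5 a = (- h) ^ n * monomial5 b + (q * monomial5 b) * (varp w + h)"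
      by (simp add: algebra_simps)
    then show ?thesis
      using assms b by (blast intro: free_of_mult free_of_power free_of_uminus[THEN iffD2])
  qed
  then obtain G q where G: "\<And>a. free_of w (G a :: 'k poly5)"
    "\<And>a. monomial5 a = G a + q a * (varp w + h)"
    by metis
  have "g = (\<Sum>a\<in>keys g. single 0 (lookup g a) * monomial5 a)"
    by (simp add: monomial5_def mult_single poly_mapping_sum_single)
  also have "\<dots> = (\<Sum>a\<in>keys g. single 0 (lookup g a) * G a) +
      (\<Sum>a\<in>keys g. single 0 (lookup g a) * q a) * (varp w + h)"
    by (simp add: G(2) sum.distrib sum_distrib_left sum_distrib_right algebra_simps)
  finally show ?thesis
  proof (rule that[rotated])
    show "free_of w (\<Sum>a\<in>keys g. single 0 (lookup g a) * G a)"
      by (intro free_of_sum free_of_mult G) (simp add: free_of_def)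
  qed
qed

section \<open>Regular sequences of length two\<close>

text \<open>The second clause says that \<open>f2\<close> is a nonzerodivisor modulo
  \<open>(J, f1)\<close>, with membership in that ideal written out. Properness is added in
  \<open>regular_seq_pair\<close>.\<close>

definition regular_pair :: "'a::comm_ring_1 set \<Rightarrow> 'a \<Rightarrow> 'a \<Rightarrow> bool" where
  "regular_pair J f1 f2 \<longleftrightarrow> (\<forall>g. g * f1 \<in> J \<longrightarrow> g \<in> J) \<and>
     (\<forall>g h. g * f2 - h * f1 \<in> J \<longrightarrow> (\<exists>h'. g - h' * f1 \<in> J))"

text \<open>Modulo \<open>varp w + h\<close> the variable \<open>w\<close> can be eliminated, which
  replaces \<open>f2\<close> by \<open>varp w' + h'\<close> and \<open>g\<close> by a
  \<open>w\<close>-free \<open>g'\<close>. The multiple of \<open>varp w + h\<close> that remains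
  must vanish modulo the ideal by its top degree in \<open>w\<close>; then \<open>w'\<close>, free
  as well, can be cancelled.\<close>

lemma regular_pair_mon_ideal:
  fixes h h' q :: "'k::comm_ring_1 poly5"
  assumes S: "upset S" "determined W S" "w \<notin> W" "w' \<notin> W"
    and free: "free_of w h" "free_of w h'" "free_of w' h'" and "w' \<noteq> w"
    and f2: "f2 = varp w' + h' + q * (varp w + h)"
  shows "regular_pair (mon_ideal S) (varp w + h) f2"
  unfolding regular_pair_def
proof (intro conjI allI impI)
  show "g \<in> mon_ideal S" if "g * (varp w + h) \<in> mon_ideal S" for g
    using var_plus_free_regular[OF S(1-3) free(1) that] .
next
  fix g k assume gk: "g * f2 - k * (varp w + h) \<in> mon_ideal S"
  obtain g' r where g': "free_of w g'" "g = g' + r * (varp w + h)"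
    using reduce_to_free[OF free(1)] .
  define e where "e = k - g * q - r * (varp w' + h')"
  have eq: "g * f2 - k * (varp w + h) = g' * (varp w' + h') - e * (varp w + h)"
    unfolding e_def f2 g'(2) by (simp add: algebra_simps)
  have I: "is_ideal (mon_ideal S :: 'k poly5 set)"
    by (rule is_ideal_mon_ideal[OF S(1)])
  have "e * (varp w + h) - g' * (varp w' + h') \<in> mon_ideal S"
    using is_ideal_mult[OF I gk, of "- 1"] by (simp add: eq)
  moreover have "free_of w (g' * (varp w' + h'))"
    by (intro free_of_mult free_of_add free_of_varp g' free \<open>w' \<noteq> w\<close>)
  ultimately have "e \<in> mon_ideal S"
    using mult_var_plus_free_in_mon_ideal[OF S(1-3) free(1)] by blast
  then have "(g' * (varp w' + h') - e * (varp w + h)) + (varp w + h) * e \<in> mon_ideal S"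
    using gk unfolding eq by (intro is_ideal_add[OF I] is_ideal_mult[OF I])
  then have "g' * (varp w' + h') \<in> mon_ideal S"
    by (simp add: algebra_simps)
  then have "g' \<in> mon_ideal S"
    by (rule var_plus_free_regular[OF S(1,2,4) free(3)])
  then show "\<exists>h'. g - h' * (varp w + h) \<in> mon_ideal S"
    using g'(2) by (intro exI[of _ r]) simp
qed

text \<open>The depth lemma for 0 \<rightarrow> R/(I \<inter> J) \<rightarrow> R/I \<times> R/J \<rightarrow> R/(I + J) \<rightarrow> 0.\<close>

lemma regular_pair_Int:
  assumes I: "is_ideal I" "regular_pair I f1 f2" and J: "is_ideal J" "regular_pair J f1 f2"
    and K: "is_ideal K" "\<And>g. g * f1 \<in> K \<Longrightarrow> g \<in> K" "I \<subseteq> K" "J \<subseteq> K"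
    and K_sum: "\<And>g. g \<in> K \<Longrightarrow> \<exists>a\<in>I. g - a \<in> J"
  shows "regular_pair (I \<inter> J) f1 f2"
  unfolding regular_pair_def
proof (intro conjI allI impI)
  show "g \<in> I \<inter> J" if "g * f1 \<in> I \<inter> J" for g
    using that I(2) J(2) unfolding regular_pair_def by blast
next
  fix g h assume gh: "g * f2 - h * f1 \<in> I \<inter> J"
  obtain a where a: "g - a * f1 \<in> I"
    using gh I(2) unfolding regular_pair_def by blast
  obtain b where b: "g - b * f1 \<in> J"
    using gh J(2) unfolding regular_pair_def by blast
  have "(a - b) * f1 \<in> K"
    using is_ideal_diff[OF K(1), of "g - b * f1" "g - a * f1"] a b K(3,4)
    by (auto simp: algebra_simps)
  \<comment> \<open>Splitting \<open>a - b\<close> along \<open>K = I + J\<close> reconciles the two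
    quotients: \<open>a - c\<close> differs from \<open>a\<close> by an element of \<open>I\<close>
    and from \<open>b\<close> by an element of \<open>J\<close>.\<close>
  then obtain c where c: "c \<in> I" "(a - b) - c \<in> J"
    using K(2) K_sum by blast
  have "(g - a * f1) + f1 * c \<in> I"
    by (intro is_ideal_add[OF I(1)] is_ideal_mult[OF I(1)] a c(1))
  also have "(g - a * f1) + f1 * c = g - (a - c) * f1"
    by (simp add: algebra_simps)
  finally have "g - (a - c) * f1 \<in> I" .
  moreover have "(g - b * f1) - f1 * ((a - b) - c) \<in> J"
    by (intro is_ideal_diff[OF J(1)] is_ideal_mult[OF J(1)] b c(2))
  then have "g - (a - c) * f1 \<in> J"
    by (simp add: algebra_simps)
  ultimately show "\<exists>h'. g - h' * f1 \<in> I \<inter> J" by blast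
qed

lemma mon_ideal_Un_decompose:
  assumes "g \<in> mon_ideal (S \<union> T)"
  shows "\<exists>a\<in>mon_ideal S. g - a \<in> mon_ideal T"
proof -
  define a where "a = (\<Sum>k\<in>keys g \<inter> S. single k (lookup g k))"
  have lookup_a: "lookup a k = (if k \<in> S then lookup g k else 0)" for k
  proof -
    have "lookup a k = (\<Sum>l\<in>keys g \<inter> S. if k = l then lookup g l else 0)"
      by (simp add: a_def lookup_sum lookup_single when_def eq_commute)
    then show ?thesis by (auto simp: in_keys_iff)
  qed
  show ?thesis
    using assms
    by (intro bexI[of _ a]) (auto simp: mon_ideal_def in_keys_iff lookup_a lookup_minus split: if_splits)
qed

lemma regular_seq_pair:
  assumes J: "is_ideal J" "J \<subseteq> mon_ideal (meets UNIV)" and f: "f1 \<in> max_ideal5" "f2 \<in> max_ideal5"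
    and "regular_pair J f1 f2"
  shows "regular_seq max_ideal5 J [f1, f2]"
proof -
  have "ideal_gen (insert f2 (ideal_gen (insert f1 J))) \<subseteq> mon_ideal (meets UNIV)"
    using J(2) f max_ideal5_subset
    by (intro ideal_gen_least is_ideal_mon_ideal[OF upset_meets] insert_subset[THEN iffD2] conjI) auto
  moreover have "1 \<notin> mon_ideal (meets UNIV)"
    by (rule one_notin_mon_ideal_meets)
  ultimately show ?thesis
    using assms(5) f unfolding regular_pair_def
    by (auto simp: regular_seq_Cons_iff[OF J(1)] regular_seq_Cons_iff[OF is_ideal_ideal_gen]
        regular_seq_Nil_iff ideal_gen_ideal[OF is_ideal_ideal_gen] ideal_gen_insert[OF J(1)])
qed

lemma depth_quot_eq:
  assumes "\<And>fs. regular_seq M J fs \<Longrightarrow> length fs \<le> n" and "regular_seq M J fs" "length fs = n"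
  shows "depth_quot M J = enat n"
  unfolding depth_quot_def
proof (rule antisym)
  show "Sup {enat (length fs) |fs. regular_seq M J fs} \<le> enat n"
    using assms(1) by (intro Sup_least) auto
  show "enat n \<le> Sup {enat (length fs) |fs. regular_seq M J fs}"
    using assms(2,3) by (intro Sup_upper) auto
qed

lemma mon_ideal_Int: "mon_ideal (S \<inter> T) = mon_ideal S \<inter> mon_ideal T"
  by (auto simp: mon_ideal_def)

lemma mon_ideal_subset_meets_UNIV:
  assumes "0 \<notin> S"
  shows "mon_ideal S \<subseteq> mon_ideal (meets UNIV)"
proof (rule mon_ideal_mono)
  show "S \<subseteq> meets UNIV"
  proof
    fix a assume "a \<in> S"
    then have "keys a \<noteq> {}" using assms by auto
    then obtain i where "i \<in> keys a" by blast
    then show "a \<in> meets UNIV"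
      unfolding meets_def by (intro CollectI bexI[of _ i]) (simp_all add: in_keys_iff)
  qed
qed

lemma determined_mono: "determined W S \<Longrightarrow> W \<subseteq> W' \<Longrightarrow> determined W' S"
  unfolding determined_def by (metis subsetD)

lemma determined_Un: "determined W S \<Longrightarrow> determined W T \<Longrightarrow> determined W (S \<union> T)"
  unfolding determined_def by (metis UnE UnI1 UnI2)

lemma upset_Un: "upset S \<Longrightarrow> upset T \<Longrightarrow> upset (S \<union> T)"
  by (auto simp: upset_def)

lemma var_cancel_mon_ideal:
  assumes "upset S" "determined W S" "w \<notin> W" "varp w * g \<in> mon_ideal S"
  shows "g \<in> mon_ideal S"
  using var_plus_free_regular[OF assms(1-3) free_of_zero, of g] assms(4)
  by (simp add: mult.commute)

lemma varp_in_max_ideal5: "varp i \<in> max_ideal5"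
  unfolding max_ideal5_def by (rule subsetD[OF subset_ideal_gen]) simp

lemma max_ideal5_add: "f \<in> max_ideal5 \<Longrightarrow> g \<in> max_ideal5 \<Longrightarrow> f + g \<in> max_ideal5"
  unfolding max_ideal5_def by (rule is_ideal_add[OF is_ideal_ideal_gen])

section \<open>The depth of a quotient with three components\<close>

text \<open>The degree complexes have the facets {x, y}, {z, u, v} and {y, u}, the complements of
  the following supports.\<close>

locale three_components =
  fixes A B C :: "expo set"
  assumes up: "upset A" "upset B" "upset C"
    and det: "determined {Z, U, V} A" "determined {X, Y} B" "determined {X, Z, V} C"
    and zero: "0 \<notin> B"
begin

definition J :: "'k::comm_ring_1 poly5 set" where
  "J = mon_ideal (A \<inter> B \<inter> C)"

lemma is_ideal_J: "is_ideal J"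
  unfolding J_def by (intro is_ideal_mon_ideal upset_Int up)

lemma J_subset: "J \<subseteq> mon_ideal (meets UNIV)"
  unfolding J_def using zero by (intro mon_ideal_subset_meets_UNIV) auto

text \<open>\<open>Y\<close> lies outside the supports of \<open>A\<close> and \<open>C\<close>,
  \<open>U\<close> outside those of \<open>B\<close> and \<open>C\<close>. Hence one of the two
  leads \<open>f1\<close> for each component and for the sums \<open>A + C\<close> and
  \<open>B + C\<close>.\<close>

abbreviation f1 :: "'k::comm_ring_1 poly5" where
  "f1 \<equiv> varp Y + varp U"

abbreviation f2 :: "'k::comm_ring_1 poly5" where
  "f2 \<equiv> varp X + varp Y + varp V"

lemma f_in_max_ideal5: "f1 \<in> max_ideal5" "f2 \<in> max_ideal5"
  by (intro max_ideal5_add varp_in_max_ideal5)+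

lemma f1_regular:
  "g * f1 \<in> mon_ideal A \<Longrightarrow> g \<in> mon_ideal A"
  "g * f1 \<in> mon_ideal B \<Longrightarrow> g \<in> mon_ideal B"
  "g * f1 \<in> mon_ideal C \<Longrightarrow> g \<in> mon_ideal C"
  "g * f1 \<in> mon_ideal (A \<union> C) \<Longrightarrow> g \<in> mon_ideal (A \<union> C)"
  "g * f1 \<in> mon_ideal (B \<union> C) \<Longrightarrow> g \<in> mon_ideal (B \<union> C)"
proof -
  have Y: "g * f1 \<in> mon_ideal S \<Longrightarrow> g \<in> mon_ideal S"
    if "upset S" "determined {X, Z, U, V} S" for S and g :: "'a poly5"
    by (rule var_plus_free_regular[OF that]) (auto intro: free_of_varp)
  have U: "g * f1 \<in> mon_ideal S \<Longrightarrow> g \<in> mon_ideal S"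
    if "upset S" "determined {X, Y, Z, V} S" for S and g :: "'a poly5"
    unfolding add.commute[of "varp Y"]
    by (rule var_plus_free_regular[OF that]) (auto intro: free_of_varp)
  have "determined {X, Z, U, V} A" "determined {X, Z, U, V} C"
    "determined {X, Y, Z, V} B" "determined {X, Y, Z, V} C"
    using det by (auto intro: determined_mono)
  then show
    "g * f1 \<in> mon_ideal A \<Longrightarrow> g \<in> mon_ideal A"
    "g * f1 \<in> mon_ideal B \<Longrightarrow> g \<in> mon_ideal B"
    "g * f1 \<in> mon_ideal C \<Longrightarrow> g \<in> mon_ideal C"
    "g * f1 \<in> mon_ideal (A \<union> C) \<Longrightarrow> g \<in> mon_ideal (A \<union> C)"
    "g * f1 \<in> mon_ideal (B \<union> C) \<Longrightarrow> g \<in> mon_ideal (B \<union> C)"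
    using up by (auto intro: Y U determined_Un upset_Un)
qed

lemma f1_regular_J: "g * f1 \<in> J \<Longrightarrow> g \<in> J"
  unfolding J_def mon_ideal_Int using f1_regular(1-3) by blast

lemma regular_seq_f1: "regular_seq max_ideal5 J [f1]"
proof -
  have "ideal_gen (insert f1 J) \<subseteq> mon_ideal (meets UNIV)"
    using J_subset f_in_max_ideal5 max_ideal5_subset
    by (intro ideal_gen_least is_ideal_mon_ideal[OF upset_meets] insert_subset[THEN iffD2] conjI)
       auto
  then show ?thesis
    using one_notin_mon_ideal_meets f_in_max_ideal5 f1_regular_J
    by (auto simp: regular_seq_Cons_iff[OF is_ideal_J] regular_seq_Nil_iff
        ideal_gen_ideal[OF is_ideal_ideal_gen])
qed

text \<open>For each component one free variable leads \<open>f1\<close> and another leads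
  \<open>f2\<close>: \<open>Y\<close> and \<open>X\<close> for \<open>A\<close>, \<open>U\<close>
  and \<open>V\<close> for \<open>B\<close>, \<open>U\<close> and \<open>Y\<close> for
  \<open>C\<close>. In the case of \<open>A\<close> the \<open>Y\<close> in \<open>f2\<close> is
  first traded for \<open>- U\<close> by subtracting \<open>f1\<close>, whence
  \<open>q = 1\<close>.\<close>

lemma regular_pair_components:
  "regular_pair (mon_ideal A) f1 f2"
  "regular_pair (mon_ideal B) f1 f2"
  "regular_pair (mon_ideal C) f1 f2"
proof -
  show "regular_pair (mon_ideal A) f1 f2"
    by (rule regular_pair_mon_ideal[OF up(1) det(1), where w' = X and h' = "varp V - varp U" and q = 1])
       (auto intro!: free_of_varp free_of_add
          simp: free_of_uminus diff_conv_add_uminus simp del: add_uminus_conv_diff)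
  show "regular_pair (mon_ideal B) f1 f2"
    unfolding add.commute[of "varp Y" "varp U"]
    by (rule regular_pair_mon_ideal[OF up(2) det(2), where w' = V and h' = "varp X + varp Y" and q = 0])
       (auto intro!: free_of_varp free_of_add)
  show "regular_pair (mon_ideal C) f1 f2"
    unfolding add.commute[of "varp Y" "varp U"]
    by (rule regular_pair_mon_ideal[OF up(3) det(3), where w' = Y and h' = "varp X + varp V" and q = 0])
       (auto intro!: free_of_varp free_of_add)
qed

lemma regular_pair_J:
  assumes "C \<subseteq> A \<union> B"
  shows "regular_pair (J :: 'k::comm_ring_1 poly5 set) f1 f2"
proof -
  have two: "regular_pair (mon_ideal (S \<inter> T) :: 'k poly5 set) f1 f2"
    if "upset S" "upset T" "regular_pair (mon_ideal S :: 'k poly5 set) f1 f2"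
      "regular_pair (mon_ideal T :: 'k poly5 set) f1 f2"
      "\<And>g :: 'k poly5. g * f1 \<in> mon_ideal (S \<union> T) \<Longrightarrow> g \<in> mon_ideal (S \<union> T)" for S T
    unfolding mon_ideal_Int
    using is_ideal_mon_ideal[OF that(1)] that(3) is_ideal_mon_ideal[OF that(2)] that(4)
      is_ideal_mon_ideal[OF upset_Un[OF that(1,2)]] that(5)
  proof (rule regular_pair_Int)
    show "mon_ideal S \<subseteq> (mon_ideal (S \<union> T) :: 'k poly5 set)"
      "mon_ideal T \<subseteq> (mon_ideal (S \<union> T) :: 'k poly5 set)"
      by (intro mon_ideal_mono Un_upper1 Un_upper2)+
  qed (assumption | erule mon_ideal_Un_decompose)+
  have AC: "regular_pair (mon_ideal (A \<inter> C) :: 'k poly5 set) f1 f2"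
    by (rule two[OF up(1,3) regular_pair_components(1,3) f1_regular(4)])
  have BC: "regular_pair (mon_ideal (B \<inter> C) :: 'k poly5 set) f1 f2"
    by (rule two[OF up(2,3) regular_pair_components(2,3) f1_regular(5)])
  have *: "(A \<inter> C) \<union> (B \<inter> C) = C" "A \<inter> B \<inter> C = (A \<inter> C) \<inter> (B \<inter> C)"
    using assms by auto
  show ?thesis
    unfolding J_def *(2)
    by (rule two[OF upset_Int[OF up(1,3)] upset_Int[OF up(2,3)] AC BC])
       (unfold *(1), rule f1_regular(3))
qed

text \<open>The cocycle is \<open>b\<close> placed on the pair \<open>Y\<close>, \<open>U\<close>,
  the facet belonging to \<open>C\<close>. The other three variables move \<open>b\<close> into
  \<open>J\<close>, which gives the cocycle condition. Since \<open>b\<close> contains neither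
  \<open>Y\<close> nor \<open>U\<close>, a coboundary has coefficient 0 at \<open>b\<close> on that
  pair.\<close>

lemma depth_le_2:
  assumes b: "b \<in> A" "b \<in> B" "b \<notin> C" "lookup b Y = 0" "lookup b U = 0"
    and socle: "\<And>i. i \<in> {X, Z, V} \<Longrightarrow> b + single i 1 \<in> C"
    and reg: "regular_seq max_ideal5 (J :: 'k::comm_ring_1 poly5 set) fs"
  shows "length fs \<le> 2"
proof -
  define c :: "var \<Rightarrow> var \<Rightarrow> 'k poly5" where
    "c i j = (if i = Y \<and> j = U then monomial5 b
      else if i = U \<and> j = Y then - monomial5 b else 0)" for i j
  have xb: "varp i * (monomial5 b :: 'k poly5) \<in> J" if "i \<in> {X, Z, V}" for i
  proof -
    have "b + single i 1 \<in> A \<inter> B \<inter> C"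
      using socle[OF that] upsetD[OF up(1) b(1)] upsetD[OF up(2) b(2)] by blast
    then show ?thesis
      unfolding J_def varp_conv_monomial monomial_mult monomial_in_mon_ideal
      by (simp only: add.commute)
  qed
  have xb': "- (varp i * (monomial5 b :: 'k poly5)) \<in> J" if "i \<in> {X, Z, V}" for i
    using is_ideal_mult[OF is_ideal_J xb[OF that], of "- 1"] by simp
  have "length fs < 3"
  proof (rule koszul_2_cocycle_regular_seq[OF is_ideal_J _ _ reg])
    fix i j k
    have "0 \<in> (J :: 'k poly5 set)"
      using is_ideal_J unfolding is_ideal_def by blast
    then show "varp k * c i j - varp j * c i k + varp i * c j k \<in> J"
      using xb xb' by (cases i; cases j; cases k) (simp_all add: c_def)
  next
    fix e :: "var \<Rightarrow> 'k poly5"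
    have zero: "lookup (varp i * g) b = 0" if "lookup b i = 0" for i and g :: "'k poly5"
    proof (rule ccontr)
      assume "lookup (varp i * g) b \<noteq> 0"
      then have "b \<in> keys (varp i * g)"
        by (rule in_keys_iff[THEN iffD2])
      then obtain a where "b = single i 1 + a"
        using keys_mult[of "varp i" g] by (auto simp: varp_def)
      then show False using that by (simp add: lookup_add)
    qed
    have "lookup (c Y U - (varp Y * e U - varp U * e Y)) b = 1"
      using zero b(4,5) by (simp add: c_def lookup_minus monomial5_def)
    then have "b \<in> keys (c Y U - (varp Y * e U - varp U * e Y))"
      by (intro in_keys_iff[THEN iffD2]) simp
    then have "c Y U - (varp Y * e U - varp U * e Y) \<notin> J"
      using b(3) by (auto simp: J_def mon_ideal_def)
    then show "\<exists>j k. c j k - (varp j * e k - varp k * e j) \<notin> J" by blast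
  qed
  then show ?thesis by simp
qed

text \<open>Modulo \<open>A\<close> the family \<open>c\<close> is the coboundary of 0, modulo
  \<open>B\<close> it is the coboundary of \<open>b\<close>. A common primitive \<open>e\<close>
  would lie in the ideal of \<open>A\<close>, by cancelling \<open>X\<close>, and
  \<open>b - e\<close> in that of \<open>B\<close>, by cancelling \<open>U\<close>. Then
  \<open>b\<close> would lie in the sum of the two, so in \<open>A\<close> or
  \<open>B\<close>.\<close>

lemma depth_le_1:
  assumes b: "b \<notin> A" "b \<notin> B" "b \<in> C"
    and socle: "\<And>i. i \<in> {Z, U, V} \<Longrightarrow> b + single i 1 \<in> A"
      "\<And>i. i \<in> {X, Y} \<Longrightarrow> b + single i 1 \<in> B"
    and reg: "regular_seq max_ideal5 (J :: 'k::comm_ring_1 poly5 set) fs"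
  shows "length fs \<le> 1"
proof -
  define c :: "var \<Rightarrow> 'k poly5" where
    "c i = (if i \<in> {Z, U, V} then varp i * monomial5 b else 0)" for i
  have xxb: "varp i * (varp j * (monomial5 b :: 'k poly5)) \<in> J" if "i \<in> {X, Y}" "j \<in> {Z, U, V}" for i j
  proof -
    have "b + single i 1 + single j 1 \<in> B" "b + single j 1 + single i 1 \<in> A"
      "b + (single i 1 + single j 1) \<in> C"
      using socle that up b by (auto intro: upsetD)
    then show ?thesis
      unfolding J_def varp_conv_monomial monomial_mult monomial_in_mon_ideal
      by (simp add: add_ac)
  qed
  have xxb': "- (varp i * (varp j * (monomial5 b :: 'k poly5))) \<in> J"
    if "i \<in> {X, Y}" "j \<in> {Z, U, V}" for i j
    using is_ideal_mult[OF is_ideal_J xxb[OF that], of "- 1"] by simp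
  have "length fs < 2"
  proof (rule koszul_1_cocycle_regular_seq[OF is_ideal_J _ _ reg])
    fix i j
    have "0 \<in> (J :: 'k poly5 set)"
      using is_ideal_J unfolding is_ideal_def by blast
    then show "varp j * c i - varp i * c j \<in> J"
      using xxb xxb' mult.left_commute[of "varp i" "varp j" "monomial5 b :: 'k poly5"]
      by (cases i; cases j) (simp_all add: c_def)
  next
    fix e :: "'k poly5"
    show "\<exists>i. c i - varp i * e \<notin> J"
    proof (rule ccontr)
      assume "\<not> (\<exists>i. c i - varp i * e \<notin> J)"
      then have *: "c X - varp X * e \<in> J" "c U - varp U * e \<in> J" by blast+
      have "varp X * (- e) \<in> mon_ideal A"
        using *(1) by (simp add: c_def J_def mon_ideal_Int)
      then have "- e \<in> mon_ideal A"
        by (rule var_cancel_mon_ideal[OF up(1) det(1), rotated]) simp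
      moreover have "varp U * (monomial5 b - e) \<in> mon_ideal B"
        using *(2) by (simp add: c_def J_def mon_ideal_Int right_diff_distrib)
      then have "monomial5 b - e \<in> mon_ideal B"
        by (rule var_cancel_mon_ideal[OF up(2) det(2), rotated]) simp
      moreover have "b \<in> keys ((monomial5 b - e) - (- e))"
        by (simp add: monomial5_def)
      then have "lookup (monomial5 b - e) b \<noteq> 0 \<or> lookup (- e) b \<noteq> 0"
        by (auto simp: in_keys_iff lookup_minus)
      ultimately show False
        using b(1,2) by (auto simp: mon_ideal_def in_keys_iff)
    qed
  qed
  then show ?thesis by simp
qed

end

section \<open>The ideal\<close>

text \<open>With the weight v + 2z, the pure part of SA consists of the monomials of weight at least 4m
  whose excess is at least 2 unless m divides the exponent of z. The two mixed generators of SC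
  have weight 4m and 4m + 1 and degree 1 and 0 in x, so a product of t of them lies outside the
  power of SB only if the second one occurs, and its excess is 1 if it occurs once, where the
  exponent of z is t + m - d.\<close>

definition SA :: "nat \<Rightarrow> expo set" where
  "SA m = {a. 1 \<le> lookup a U \<or>
    4 * m + (if m dvd lookup a Z then 0 else 2) \<le> lookup a V + 2 * lookup a Z}"

definition SB :: "expo set" where
  "SB = {a. 1 \<le> lookup a X + lookup a Y}"

definition SC :: "nat \<Rightarrow> nat \<Rightarrow> expo set" where
  "SC m d = {a. 1 \<le> lookup a X \<and> 4 * m - 2 \<le> lookup a V \<and> 1 \<le> lookup a Z \<or>
    2 * m + 2 * d - 1 \<le> lookup a V \<and> m + 1 - d \<le> lookup a Z \<or>
    8 * m + 1 \<le> lookup a X \<or> 8 * m + 1 \<le> lookup a V \<or> 8 * m + 1 \<le> lookup a Z}"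

lemma upset_SA: "upset (SA m)"
  unfolding upset_def
proof (intro ballI allI)
  fix a b assume "a \<in> SA m"
  then show "a + b \<in> SA m"
    \<comment> \<open>A factor z may destroy divisibility by \<open>m\<close>, but its weight 2 pays
      exactly for the excess then required.\<close>
    by (cases "lookup b Z = 0") (auto simp: SA_def lookup_add split: if_splits)
qed

lemma upset_SB: "upset SB"
  by (auto simp: upset_def SB_def lookup_add)

lemma upset_SC: "upset (SC m d)"
  by (auto simp: upset_def SC_def lookup_add)

lemma determined_SA: "determined {Z, U, V} (SA m)"
  by (auto simp: determined_def SA_def)

lemma determined_SB: "determined {X, Y} SB"
  by (auto simp: determined_def SB_def)

lemma determined_SC: "determined {X, Z, V} (SC m d)"
  by (auto simp: determined_def SC_def)

section \<open>Powers of the three exponent sets\<close>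

lemma sumset_pow_SucI:
  assumes "b \<in> S" "\<And>i. lookup b i \<le> lookup a i" "a - b \<in> sumset_pow S t"
  shows "a \<in> sumset_pow S (Suc t)"
proof -
  have "a = b + (a - b)"
    by (rule poly_mapping_eqI) (use assms(2) in \<open>simp add: lookup_add lookup_minus\<close>)
  then show ?thesis
    using assms by auto
qed

lemma sumset_pow_SB: "a \<in> sumset_pow SB t \<longleftrightarrow> t \<le> lookup a X + lookup a Y"
proof
  assume "a \<in> sumset_pow SB t"
  then show "t \<le> lookup a X + lookup a Y"
  proof (induction t arbitrary: a)
    case (Suc t)
    then obtain b c where "b \<in> SB" "c \<in> sumset_pow SB t" "a = b + c" by auto
    then show ?case
      using Suc.IH[of c] by (auto simp: SB_def lookup_add)
  qed simp
next
  assume "t \<le> lookup a X + lookup a Y"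
  then show "a \<in> sumset_pow SB t"
  proof (induction t arbitrary: a)
    case (Suc t)
    define b where "b = (if lookup a X = 0 then single Y 1 else single X (1 :: nat))"
    show ?case
      by (rule sumset_pow_SucI[of b])
         (use Suc in \<open>auto simp: b_def SB_def lookup_minus lookup_single when_def\<close>)
  qed simp
qed

text \<open>Weights add up. If \<open>m\<close> divides the z exponent of every factor, it divides
  that of the product; otherwise some factor already brings the excess 2. The zeroth power is
  \<open>UNIV\<close> and imposes nothing, hence the alternative \<open>t = 0\<close>.\<close>

lemma sumset_pow_SA_bound:
  assumes "a \<in> sumset_pow (SA m) t" "lookup a U = 0"
  shows "4 * m * t + (if m dvd lookup a Z then 0 else 2) \<le> lookup a V + 2 * lookup a Z \<or> t = 0"
  using assms
proof (induction t arbitrary: a)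
  case (Suc t)
  then obtain b c where bc: "b \<in> SA m" "c \<in> sumset_pow (SA m) t" "a = b + c" by auto
  then have U: "lookup b U = 0" "lookup c U = 0"
    using Suc.prems by (auto simp: lookup_add)
  then have b: "4 * m + (if m dvd lookup b Z then 0 else 2) \<le> lookup b V + 2 * lookup b Z"
    using bc(1) by (simp add: SA_def)
  show ?case
  proof (cases "t = 0")
    case True
    have "upset (SA m)" by (rule upset_SA)
    then have "a \<in> SA m" using bc by (auto intro: upsetD)
    then show ?thesis using True Suc.prems by (simp add: SA_def)
  next
    case False
    then show ?thesis
      using Suc.IH[OF bc(2) U(2)] b bc(3)
      by (auto simp: lookup_add algebra_simps dvd_add split: if_splits)
  qed
qed simp

text \<open>Factors z^(2m) have weight exactly 4m and preserve divisibility by \<open>m\<close>, so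
  they are split off while possible.\<close>

lemma sumset_pow_SA_I:
  assumes "4 * m * t + (if m dvd lookup a Z then 0 else 2) \<le> lookup a V + 2 * lookup a Z"
  shows "a \<in> sumset_pow (SA m) t"
  using assms
proof (induction t arbitrary: a)
  case (Suc t)
  show ?case
  proof (cases "2 * m \<le> lookup a Z")
    case True
    show ?thesis
    proof (rule sumset_pow_SucI[of "single Z (2 * m)"])
      show "single Z (2 * m) \<in> SA m"
        by (simp add: SA_def lookup_single)
      show "lookup (single Z (2 * m)) i \<le> lookup a i" for i
        using True by (simp add: lookup_single when_def)
      have "m dvd lookup a Z - 2 * m \<longleftrightarrow> m dvd lookup a Z"
        using True by (metis dvd_diff_nat dvd_diffD dvd_triv_right)
      then show "a - single Z (2 * m) \<in> sumset_pow (SA m) t"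
        using Suc.prems True
        by (intro Suc.IH) (auto simp: lookup_minus lookup_single when_def split: if_splits)
    qed
  next
    case False
    \<comment> \<open>One factor absorbs all of z together with the excess 2 if it is due. The rest
      has z exponent 0, which \<open>m\<close> divides, so no excess is demanded any more.\<close>
    define b where "b = single V (4 * m - 2 * lookup a Z + (if m dvd lookup a Z then 0 else 2)) +
      single Z (lookup a Z)"
    have b: "lookup b V = 4 * m - 2 * lookup a Z + (if m dvd lookup a Z then 0 else 2)"
      "lookup b Z = lookup a Z" "lookup b X = 0" "lookup b Y = 0" "lookup b U = 0"
      by (simp_all add: b_def lookup_add lookup_single)
    show ?thesis
    proof (rule sumset_pow_SucI[of b])
      show "b \<in> SA m"
        using b False by (simp add: SA_def)
      show "lookup b i \<le> lookup a i" for i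
        using b Suc.prems False by (cases i) (auto split: if_splits)
      show "a - b \<in> sumset_pow (SA m) t"
        using Suc.prems False
        by (intro Suc.IH) (auto simp: lookup_minus b split: if_splits)
    qed
  qed
qed simp

text \<open>The five numbers count the generators used: the two mixed ones, then the pure powers of
  x, v and z.\<close>

lemma sumset_pow_SC_bound:
  assumes "a \<in> sumset_pow (SC m d) t"
  shows "\<exists>n1 n2 n3 n4 n5. n1 + n2 + n3 + n4 + n5 = t \<and>
    n1 + (8 * m + 1) * n3 \<le> lookup a X \<and>
    (4 * m - 2) * n1 + (2 * m + 2 * d - 1) * n2 + (8 * m + 1) * n4 \<le> lookup a V \<and>
    n1 + (m + 1 - d) * n2 + (8 * m + 1) * n5 \<le> lookup a Z"
    (is "\<exists>n1 n2 n3 n4 n5. ?P a t n1 n2 n3 n4 n5")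
  using assms
proof (induction t arbitrary: a)
  case (Suc t)
  then obtain b c where bc: "b \<in> SC m d" "c \<in> sumset_pow (SC m d) t" "a = b + c" by auto
  then obtain n1 n2 n3 n4 n5 where IH: "?P c t n1 n2 n3 n4 n5"
    using Suc.IH by blast
  note defs = bc(3) lookup_add mult_Suc_right
  consider "1 \<le> lookup b X" "4 * m - 2 \<le> lookup b V" "1 \<le> lookup b Z"
    | "2 * m + 2 * d - 1 \<le> lookup b V" "m + 1 - d \<le> lookup b Z"
    | "8 * m + 1 \<le> lookup b X" | "8 * m + 1 \<le> lookup b V" | "8 * m + 1 \<le> lookup b Z"
    using bc(1) by (auto simp: SC_def)
  then show ?case
  proof cases
    case 1
    then have "?P a (Suc t) (Suc n1) n2 n3 n4 n5"
      using IH unfolding defs by linarith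
    then show ?thesis by blast
  next
    case 2
    then have "?P a (Suc t) n1 (Suc n2) n3 n4 n5"
      using IH unfolding defs by linarith
    then show ?thesis by blast
  next
    case 3
    then have "?P a (Suc t) n1 n2 (Suc n3) n4 n5"
      using IH unfolding defs by linarith
    then show ?thesis by blast
  next
    case 4
    then have "?P a (Suc t) n1 n2 n3 (Suc n4) n5"
      using IH unfolding defs by linarith
    then show ?thesis by blast
  next
    case 5
    then have "?P a (Suc t) n1 n2 n3 n4 (Suc n5)"
      using IH unfolding defs by linarith
    then show ?thesis by blast
  qed
qed simp

lemma diff_mult_add_mult: "c \<le> b \<Longrightarrow> (b - c) * n + c * n = b * n" for b c n :: nat
  by (metis add_mult_distrib le_add_diff_inverse2)

lemma sumset_pow_SA_U:
  assumes "1 \<le> lookup a U"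
    and "4 * m * t + (if m dvd lookup a Z then 0 else 2) \<le> lookup a V + 2 * lookup a Z"
  shows "a \<in> sumset_pow (SA m) (Suc t)"
proof (rule sumset_pow_SucI[of "single U 1"])
  show "single U 1 \<in> SA m"
    by (simp add: SA_def)
  show "lookup (single U 1) i \<le> lookup a i" for i
    using assms(1) by (simp add: lookup_single when_def)
  show "a - single U 1 \<in> sumset_pow (SA m) t"
    using assms(2) by (intro sumset_pow_SA_I) (simp add: lookup_minus lookup_single)
qed

lemma sumset_pow_SC_pure:
  assumes "i \<in> {X, Z, V}" "(8 * m + 1) * t \<le> lookup a i"
  shows "a \<in> sumset_pow (SC m d) t"
  using assms(2)
proof (induction t arbitrary: a)
  case (Suc t)
  have "8 * m + 1 \<le> lookup a i"
    using Suc.prems unfolding mult_Suc_right by linarith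
  show ?case
  proof (rule sumset_pow_SucI[of "single i (8 * m + 1)"])
    show "single i (8 * m + 1) \<in> SC m d"
      using assms(1) by (auto simp: SC_def)
    show "lookup (single i (8 * m + 1)) j \<le> lookup a j" for j
      using \<open>8 * m + 1 \<le> lookup a i\<close> by (auto simp: lookup_single when_def)
    show "a - single i (8 * m + 1) \<in> sumset_pow (SC m d) t"
      using Suc.prems by (intro Suc.IH) (simp add: lookup_minus)
  qed
qed simp

lemma sumset_pow_SC_mixed:
  assumes "t \<le> lookup a X" "(4 * m - 2) * t + (2 * m + 2 * d - 1) \<le> lookup a V"
    "t + (m + 1 - d) \<le> lookup a Z"
  shows "a \<in> sumset_pow (SC m d) (Suc t)"
  using assms
proof (induction t arbitrary: a)
  case 0
  then show ?case
    by (intro sumset_pow_SucI[of a]) (auto simp: SC_def)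
next
  case (Suc t)
  define b where "b = single X 1 + single V (4 * m - 2) + single Z (1 :: nat)"
  have b: "lookup b X = 1" "lookup b V = 4 * m - 2" "lookup b Z = 1" "lookup b Y = 0" "lookup b U = 0"
    by (simp_all add: b_def lookup_add lookup_single)
  show ?case
  proof (rule sumset_pow_SucI[of b])
    show "b \<in> SC m d" by (simp add: SC_def b)
    show "lookup b i \<le> lookup a i" for i
      using Suc.prems b by (cases i) auto
    show "a - b \<in> sumset_pow (SC m d) (Suc t)"
      using Suc.prems by (intro Suc.IH) (auto simp: lookup_minus b)
  qed
qed

section \<open>The congruence condition and the test monomials\<close>

text \<open>Only the pure powers of x weigh less than 4m. But outside the power of \<open>SB\<close>
  each of them forces more than 8m factors without x, each with excess at least 1, which outweighs
  the loss of 4m. So the total excess is at least 2 apart from one distribution, where the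
  congruence supplies divisibility.\<close>

lemma sumset_pow_SC_subset:
  assumes m: "m \<ge> 2" and d: "d < m" and t: "t mod m = d"
  shows "sumset_pow (SC m d) t \<subseteq> sumset_pow (SA m) t \<union> sumset_pow SB t"
proof
  fix a assume "a \<in> sumset_pow (SC m d) t"
  then obtain n1 n2 n3 n4 n5 where n: "n1 + n2 + n3 + n4 + n5 = t"
    "n1 + (8 * m + 1) * n3 \<le> lookup a X"
    "(4 * m - 2) * n1 + (2 * m + 2 * d - 1) * n2 + (8 * m + 1) * n4 \<le> lookup a V"
    "n1 + (m + 1 - d) * n2 + (8 * m + 1) * n5 \<le> lookup a Z"
    using sumset_pow_SC_bound by blast
  show "a \<in> sumset_pow (SA m) t \<union> sumset_pow SB t"
  proof (cases "t \<le> lookup a X")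
    case True
    then show ?thesis by (simp add: sumset_pow_SB)
  next
    case False
    have "(4 * m - 2) * n1 + 2 * n1 = 4 * m * n1" "(2 * m + 2 * d - 1) * n2 + 1 * n2 = (2 * m + 2 * d) * n2"
      "(m + 1 - d) * n2 + d * n2 = (m + 1) * n2"
      using m d by (intro diff_mult_add_mult; simp)+
    then have weight: "4 * (m * n1) + 4 * (m * n2) + n2 + 8 * (m * n4) + n4 + 16 * (m * n5) + 2 * n5 \<le>
        lookup a V + 2 * lookup a Z"
      using n(3,4) by (simp add: algebra_simps)
    have t_eq: "4 * m * t = 4 * (m * n1) + 4 * (m * n2) + 4 * (m * n3) + 4 * (m * n4) + 4 * (m * n5)"
      unfolding n(1)[symmetric] by (simp add: algebra_simps)
    have X: "8 * (m * n3) < n2 + n4 + n5"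
      using False n(1,2) by (simp add: algebra_simps)
    show ?thesis
    \<comment> \<open>The exceptional distribution: the second mixed generator once, the first one
      otherwise, with excess 1.\<close>
    proof (cases "n3 = 0 \<and> n2 = 1 \<and> n4 = 0 \<and> n5 = 0")
      case False
      have "4 * m * t + 2 \<le> lookup a V + 2 * lookup a Z"
      proof (cases "n3 = 0")
        case True
        have "2 \<le> n2 \<or> m \<le> m * n4 \<and> 1 \<le> n4 \<or> m \<le> m * n5"
          using X False True by auto
        moreover have "4 * m * t = 4 * (m * n1) + 4 * (m * n2) + 4 * (m * n4) + 4 * (m * n5)"
          using t_eq True by simp
        ultimately show ?thesis
          using weight m by linarith
      next
        case False
        then have "m \<le> m * n3" by simp
        then show ?thesis
          using weight m X unfolding t_eq by linarith
      qed
      then show ?thesis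
        by (intro UnI1 sumset_pow_SA_I) auto
    next
      case True
      \<comment> \<open>The z exponent of \<open>a\<close> itself may be larger and not divisible by
        \<open>m\<close>; hence the passage to the divisor \<open>b\<close>, whose z exponent is
        exactly \<open>t + m - d\<close>.\<close>
      define b where "b = single V ((4 * m - 2) * n1 + (2 * m + 2 * d - 1)) + single Z (n1 + (m + 1 - d))"
      have b: "lookup b V = (4 * m - 2) * n1 + (2 * m + 2 * d - 1)" "lookup b Z = n1 + (m + 1 - d)"
        "lookup b X = 0" "lookup b Y = 0" "lookup b U = 0"
        by (simp_all add: b_def lookup_add lookup_single)
      have "n1 + (m + 1 - d) = (t div m) * m + m"
        using True n(1) t d div_mult_mod_eq[of t m] by linarith
      then have "m dvd lookup b Z"
        by (simp add: b)
      moreover have "4 * m * t \<le> lookup b V + 2 * lookup b Z"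
        using True n(1) d m diff_mult_add_mult[of 2 "4 * m" n1] by (auto simp: b algebra_simps)
      ultimately have "b \<in> sumset_pow (SA m) t"
        by (intro sumset_pow_SA_I) simp
      moreover have "lookup b i \<le> lookup a i" for i
        using True n(3,4) b by (cases i) auto
      ultimately show ?thesis
        using upset_lookup_le[OF upset_sumset_pow] by blast
    qed
  qed
qed

text \<open>The pure powers in \<open>SC\<close> bound the exponents of x, z and v outside its
  power, so an element of maximal degree among the candidates exists; its maximality is the socle
  condition.\<close>

lemma sumset_pow_SC_socle:
  assumes t: "t \<ge> 1" and d: "d < m"
  obtains b where "b \<in> sumset_pow (SA m) t" "b \<in> sumset_pow SB t" "b \<notin> sumset_pow (SC m d) t"
    "lookup b Y = 0" "lookup b U = 0"
    "\<forall>i\<in>{X, Z, V}. b + single i 1 \<in> sumset_pow (SC m d) t"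
proof -
  define P where "P b \<longleftrightarrow> b \<in> sumset_pow (SA m) t \<and> b \<in> sumset_pow SB t \<and>
    b \<notin> sumset_pow (SC m d) t \<and> lookup b Y = 0 \<and> lookup b U = 0" for b
  define f where "f b = lookup b X + lookup b Z + lookup b V" for b :: expo
  \<comment> \<open>Without z no mixed generator divides this monomial, and its degree
    \<open>(4 * m + 1) * t\<close> is too small for \<open>t\<close> pure powers of degree
    \<open>8 * m + 1\<close>.\<close>
  define a where "a = single X t + single V (4 * m * t)"
  have a: "lookup a X = t" "lookup a V = 4 * m * t" "lookup a Y = 0" "lookup a Z = 0" "lookup a U = 0"
    by (simp_all add: a_def lookup_add lookup_single)
  have "a \<notin> sumset_pow (SC m d) t"
  proof
    assume "a \<in> sumset_pow (SC m d) t"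
    then obtain n1 n2 n3 n4 n5 where n: "n1 + n2 + n3 + n4 + n5 = t"
      "n1 + (8 * m + 1) * n3 \<le> t"
      "(4 * m - 2) * n1 + (2 * m + 2 * d - 1) * n2 + (8 * m + 1) * n4 \<le> 4 * m * t"
      "n1 + (m + 1 - d) * n2 + (8 * m + 1) * n5 \<le> 0"
      using sumset_pow_SC_bound[of a m d t] unfolding a by blast
    then have "n1 = 0" "n2 = 0" "n5 = 0"
      using d by auto
    moreover from this have "4 * (m * t) = 4 * (m * n3) + 4 * (m * n4)" "n4 + n3 = t"
      using n(1) by (auto simp: algebra_simps)
    ultimately have "8 * (m * n4) + n4 \<le> 4 * (m * n3) + 4 * (m * n4)" "8 * (m * n3) \<le> n4"
      using n(2,3) by (auto simp: algebra_simps)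
    then have "n4 = 0" "m * n3 = 0" by linarith+
    then show False
      using t d \<open>n4 + n3 = t\<close> by auto
  qed
  moreover have "a \<in> sumset_pow (SA m) t"
    by (rule sumset_pow_SA_I) (simp add: a)
  ultimately have "P a"
    by (simp add: P_def sumset_pow_SB a)
  have bound: "f b \<le> 3 * ((8 * m + 1) * t)" if "P b" for b
  proof -
    have "lookup b i \<le> (8 * m + 1) * t" if "i \<in> {X, Z, V}" for i
    proof (rule ccontr)
      assume "\<not> lookup b i \<le> (8 * m + 1) * t"
      then have "b \<in> sumset_pow (SC m d) t"
        by (intro sumset_pow_SC_pure[OF that]) linarith
      then show False using \<open>P b\<close> by (simp add: P_def)
    qed
    from this[of X] this[of Z] this[of V] show ?thesis
      by (simp add: f_def)
  qed
  have "\<exists>b. P b \<and> (\<forall>c. P c \<longrightarrow> f c \<le> f b)"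
    by (rule ex_has_greatest_nat[of P a f "Suc (3 * ((8 * m + 1) * t))"])
       (use \<open>P a\<close> bound in \<open>auto simp: less_Suc_eq_le\<close>)
  then obtain b where b: "P b" "\<And>c. P c \<Longrightarrow> f c \<le> f b"
    by blast
  have socle: "b + single i 1 \<in> sumset_pow (SC m d) t" if "i \<in> {X, Z, V}" for i
  proof (rule ccontr)
    assume "b + single i 1 \<notin> sumset_pow (SC m d) t"
    moreover have "b + single i 1 \<in> sumset_pow (SA m) t" "b + single i 1 \<in> sumset_pow SB t"
      using b(1) upsetD[OF upset_sumset_pow] by (simp_all add: P_def)
    moreover have "lookup (b + single i 1) Y = 0" "lookup (b + single i 1) U = 0"
      using that b(1) by (auto simp: P_def lookup_add lookup_single)
    ultimately have "P (b + single i 1)"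
      by (simp add: P_def)
    then have "f (b + single i 1) \<le> f b" by (rule b(2))
    then show False
      using that by (auto simp: f_def lookup_add lookup_single)
  qed
  show ?thesis
    by (rule that[of b]) (use b(1) socle in \<open>simp_all add: P_def\<close>)
qed

text \<open>The witness is the critical product of \<open>t - 1\<close> first mixed generators and
  one second. It misses the power of \<open>SB\<close> by one x and has weight
  \<open>4 * m * t + 1\<close>, so z or v lifts the excess to at least 2, whatever the residue of
  the z exponent.\<close>

lemma sumset_pow_SC_isolated:
  assumes m: "m \<ge> 2" and d: "d < m" and t: "t \<ge> 1" "t mod m \<noteq> d"
  obtains b where "b \<notin> sumset_pow (SA m) t" "b \<notin> sumset_pow SB t" "b \<in> sumset_pow (SC m d) t"
    "\<forall>i\<in>{Z, U, V}. b + single i 1 \<in> sumset_pow (SA m) t"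
    "\<forall>i\<in>{X, Y}. b + single i 1 \<in> sumset_pow SB t"
proof -
  obtain t' where t': "t = Suc t'"
    using t(1) by (cases t) auto
  define b where "b = single X t' + single V ((4 * m - 2) * t' + (2 * m + 2 * d - 1)) +
    single Z (t' + (m + 1 - d))"
  have b: "lookup b V = (4 * m - 2) * t' + (2 * m + 2 * d - 1)" "lookup b Z = t' + (m + 1 - d)"
    "lookup b X = t'" "lookup b Y = 0" "lookup b U = 0"
    by (simp_all add: b_def lookup_add lookup_single)
  have "(4 * m - 2) * t' + 2 * t' = 4 * m * t'"
    using m by (intro diff_mult_add_mult) simp
  moreover have "(2 * m + 2 * d - 1) + 2 * (m + 1 - d) = 4 * m + 1"
    using m d by linarith
  moreover have "A + 2 * t' = k \<Longrightarrow> B + 2 * C = l \<Longrightarrow> (A + B) + 2 * (t' + C) = k + l" for A B C k l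
    by simp
  ultimately have "lookup b V + 2 * lookup b Z = 4 * m * t' + (4 * m + 1)"
    unfolding b by blast
  then have weight: "lookup b V + 2 * lookup b Z = 4 * m * t + 1"
    by (simp add: t')
  have not_dvd: "\<not> m dvd lookup b Z"
  proof
    assume "m dvd lookup b Z"
    then obtain k where "lookup b Z = m * k" ..
    then have "t + m = m * k + d"
      using d by (simp add: b t')
    then have "(t + m) mod m = (m * k + d) mod m" by simp
    then show False using t(2) d by simp
  qed
  show ?thesis
  proof (rule that)
    show "b \<notin> sumset_pow (SA m) t"
      using sumset_pow_SA_bound[of b m t] weight not_dvd b t' by auto
    show "b \<notin> sumset_pow SB t"
      unfolding sumset_pow_SB b by (simp add: t')
    show "b \<in> sumset_pow (SC m d) t"
      unfolding t' by (rule sumset_pow_SC_mixed) (simp_all add: b)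
    show "\<forall>i\<in>{X, Y}. b + single i 1 \<in> sumset_pow SB t"
      unfolding sumset_pow_SB by (auto simp: b t' lookup_add lookup_single)
    show "\<forall>i\<in>{Z, U, V}. b + single i 1 \<in> sumset_pow (SA m) t"
    proof
      fix i assume "i \<in> {Z, U, V}"
      show "b + single i 1 \<in> sumset_pow (SA m) t"
      proof (cases "i = U")
        case True
        \<comment> \<open>The variable u alone serves as one of the \<open>t\<close> factors, so the
          rest has to reach only this weight.\<close>
        have "4 * m * t' + 2 \<le> lookup b V + 2 * lookup b Z"
          using weight m by (simp add: t')
        then show ?thesis
          unfolding t' True by (intro sumset_pow_SA_U) (auto simp: lookup_add lookup_single)
      next
        case False
        then show ?thesis
          using \<open>i \<in> {Z, U, V}\<close> weight not_dvd
          by (intro sumset_pow_SA_I) (auto simp: lookup_add lookup_single)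
      qed
    qed
  qed
qed

section \<open>The depth function\<close>

theorem theorem4p4:
  fixes m d :: nat
  assumes "m \<ge> 2" and "d < m"
  shows "\<exists>I :: 'k::field poly5 set. monomial_ideal I \<and>
           (\<forall>t::nat. t \<ge> 1 \<longrightarrow>
              depth_quot max_ideal5 (symbolic_power I t) =
                (if t mod m = d then 2 else 1))"
proof -
  define \<W> :: "var set set" where "\<W> = {{Z, U, V}, {X, Y}, {X, Z, V}}"
  define S where "S W = (if W = {Z, U, V} then SA m else if W = {X, Y} then SB else SC m d)" for W
  \<comment> \<open>Multipliers outside the respective prime: the power of x lies in
    \<open>SB\<close> and \<open>SC\<close>, the power of z in \<open>SA\<close> and
    \<open>SC\<close>; in the product of y and u, y lies in \<open>SB\<close> and u in
    \<open>SA\<close>.\<close>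
  define c :: "var set \<Rightarrow> expo" where "c W =
    (if W = {Z, U, V} then single X (8 * m + 1) else if W = {X, Y} then single Z (8 * m + 1)
     else single Y 1 + single U 1)" for W
  have neq: "{X, Y} \<noteq> {Z, U, V}" "{X, Z, V} \<noteq> {Z, U, V}" "{X, Z, V} \<noteq> {X, Y}" by auto
  have S: "S {Z, U, V} = SA m" "S {X, Y} = SB" "S {X, Z, V} = SC m d"
    unfolding S_def using neq by simp_all
  have c: "c {Z, U, V} = single X (8 * m + 1)" "c {X, Y} = single Z (8 * m + 1)"
    "c {X, Z, V} = single Y 1 + single U 1"
    unfolding c_def using neq by simp_all
  have INT: "(\<Inter>W\<in>\<W>. f (S W)) = f (SA m) \<inter> f SB \<inter> f (SC m d)" for f :: "expo set \<Rightarrow> expo set"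
    by (simp add: \<W>_def S Int_assoc)
  define I :: "'k poly5 set" where "I = mon_ideal (\<Inter>W\<in>\<W>. S W)"
  have up: "upset (S W)" if "W \<in> \<W>" for W
    using that by (auto simp: \<W>_def S upset_SA upset_SB upset_SC)
  have sym: "symbolic_power I t = mon_ideal (\<Inter>W\<in>\<W>. sumset_pow (S W) t)" for t
    unfolding I_def
  proof (rule symbolic_power_mon_ideal[where N = "8 * m + 1" and c = c])
    show "finite \<W>" by (simp add: \<W>_def)
    show "determined W (S W)" if "W \<in> \<W>" for W
      using that by (auto simp: \<W>_def S determined_SA determined_SB determined_SC)
    show "S W \<subseteq> meets W" if "W \<in> \<W>" for W
      using that assms unfolding \<W>_def
      by (elim insertE emptyE; hypsubst) (force simp: S SA_def SB_def SC_def meets_def)+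
    show "single i (8 * m + 1) \<in> S W" if "W \<in> \<W>" "i \<in> W" for W i
      using that unfolding \<W>_def
      by (elim insertE emptyE; hypsubst)
         (auto simp: S SA_def SB_def SC_def lookup_single)
    show "W = W'" if "W \<in> \<W>" "W' \<in> \<W>" "W \<subseteq> W'" for W W'
      using that unfolding \<W>_def by auto
    show "c W \<notin> meets W" if "W \<in> \<W>" for W
      using that unfolding \<W>_def
      by (elim insertE emptyE; hypsubst) (auto simp: c meets_def lookup_add lookup_single)
    show "c W + a \<in> S W'" if "W \<in> \<W>" "W' \<in> \<W>" "a \<in> S W" for W W' a
    proof (cases "W = W'")
      case True
      then show ?thesis using upsetD'[OF up] that by blast
    next
      case False
      then show ?thesis
        using that unfolding \<W>_def
        by (elim insertE emptyE; hypsubst)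
           (auto simp: c S SA_def SB_def SC_def lookup_add lookup_single)
    qed
  qed (rule up)
  have "depth_quot max_ideal5 (symbolic_power I t) = (if t mod m = d then 2 else 1)" if t: "t \<ge> 1" for t
  proof -
    interpret three_components "sumset_pow (SA m) t" "sumset_pow SB t" "sumset_pow (SC m d) t"
    proof
      show "0 \<notin> sumset_pow SB t"
        using t by (simp add: sumset_pow_SB)
    qed (intro upset_sumset_pow determined_sumset_pow determined_SA determined_SB determined_SC)+
    have J: "symbolic_power I t = J"
      unfolding sym J_def INT[of "\<lambda>S. sumset_pow S t"] ..
    show ?thesis
    proof (cases "t mod m = d")
      case True
      obtain b where "b \<in> sumset_pow (SA m) t" "b \<in> sumset_pow SB t" "b \<notin> sumset_pow (SC m d) t"
        "lookup b Y = 0" "lookup b U = 0"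
        "\<forall>i\<in>{X, Z, V}. b + single i 1 \<in> sumset_pow (SC m d) t"
        using sumset_pow_SC_socle[OF t assms(2)] .
      note le = depth_le_2[OF this(1-5) this(6)[rule_format]]
      have reg: "regular_seq max_ideal5 (J :: 'k poly5 set) [f1, f2]"
        by (rule regular_seq_pair[OF is_ideal_J J_subset f_in_max_ideal5
              regular_pair_J[OF sumset_pow_SC_subset[OF assms True]]])
      have "depth_quot max_ideal5 (J :: 'k poly5 set) = enat 2"
        using depth_quot_eq[OF le reg] by simp
      then show ?thesis
        using True J by (simp add: numeral_eq_enat)
    next
      case False
      obtain b where "b \<notin> sumset_pow (SA m) t" "b \<notin> sumset_pow SB t" "b \<in> sumset_pow (SC m d) t"
        "\<forall>i\<in>{Z, U, V}. b + single i 1 \<in> sumset_pow (SA m) t"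
        "\<forall>i\<in>{X, Y}. b + single i 1 \<in> sumset_pow SB t"
        using sumset_pow_SC_isolated[OF assms t False] .
      note le = depth_le_1[OF this(1-3) this(4,5)[rule_format]]
      have "depth_quot max_ideal5 (J :: 'k poly5 set) = enat 1"
        using depth_quot_eq[OF le regular_seq_f1] by simp
      then show ?thesis
        using False J by (simp add: one_enat_def)
    qed
  qed
  moreover have "monomial_ideal I"
    unfolding monomial_ideal_def I_def by (rule exI, rule mon_ideal_eq_ideal_gen[OF upset_INT[OF up]])
  ultimately show ?thesis by blast
qed

end
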